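(* Let $S\subseteq\mathbb{C}$ and let $G$ be an $S$-diagonalizable simple graph with $p$ connected components having $v_1,v_2,\ldots,v_p$ vertices, respectively. Then the complement $G^{\textup{c}}$ is $S$-diagonalizable if and only if the vector $(v_1,v_2,\ldots,v_p)$ is $S$-balanced. Furthermore, if $G$ has $S$-bandwidth $k$, then $G^{\textup{c}}$ has $S$-bandwidth at most $\max\{p-1,k\}$.
   Context: For a simple graph with adjacency matrix $A$ and degree matrix $D$, the Laplacian is $L=D-A$. A graph is $S$-diagonalizable if there is an invertible matrix $P$ with all entries in $S$ such that $P^{-1}LP$ is diagonal. The bandwidth of a square matrix $M$ is the smallest positive integer $k$ with $m_{i,j}=0$ whenever $|i-j|\ge k$. The $S$-bandwidth of a graph is $\infty$ if it is not $S$-diagonalizable, and otherwise the smallest positive integer $k$ for which there is a matrix $P$ with entries in $S$, $P^{-1}LP$ diagonal, and $P^TP$ (plain transpose) of bandwidth $k$. A vector $\mathbf{v}\in\mathbb{C}^p$ with $p\ge2$ is $S$-balanced if there exists a $(p-1)\times p$ matrix with all entries in $S$ whose null space equals $\mathrm{span}(\mathbf{v})$; for $p=1$ a vector is taken to be $S$-balanced iff it is non-zero.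
   Formalization: The bandwidth bound is stated only when the complement is S-diagonalizable (equivalently, the vector is S-balanced); otherwise its S-bandwidth is infinite and the bound fails, e.g. S={-1,0,1}, G=K_1+K_2. *)

theory Defs
  imports
    "Graph_Theory.Pair_Digraph"
    "Graph_Theory.Digraph_Component"
    "Jordan_Normal_Form.Matrix_Kernel"
    "HOL-Library.Extended_Nat"
begin

text \<open>A simple graph is a \<^locale>\<open>pair_graph\<close>: finite, loopless, with a symmetric set of arcs
  \<^term>\<open>parcs G\<close> containing both orientations of every edge.\<close>

definition complement_graph :: "'a pair_pre_digraph \<Rightarrow> 'a pair_pre_digraph" where
  "complement_graph G = \<lparr> pverts = pverts G,
     parcs = {(u, v). u \<in> pverts G \<and> v \<in> pverts G \<and> u \<noteq> v \<and> (u, v) \<notin> parcs G} \<rparr>"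

text \<open>Rows and columns of the matrices of a graph are indexed by \<open>0, \<dots>, n - 1\<close>, where the list
  \<open>vs\<close> enumerates the \<open>n\<close> vertices without repetition.\<close>

definition adjacency_mat :: "'a list \<Rightarrow> 'a pair_pre_digraph \<Rightarrow> complex mat" where
  "adjacency_mat vs G = mat (length vs) (length vs)
     (\<lambda>(i, j). if (vs ! i, vs ! j) \<in> parcs G then 1 else 0)"

text \<open>In a symmetric digraph the out-degree is the degree of the underlying simple graph.\<close>

definition degree_mat :: "'a list \<Rightarrow> 'a pair_pre_digraph \<Rightarrow> complex mat" where
  "degree_mat vs G = mat (length vs) (length vs)
     (\<lambda>(i, j). if i = j then of_nat (out_degree (with_proj G) (vs ! i)) else 0)"

definition laplacian :: "'a list \<Rightarrow> 'a pair_pre_digraph \<Rightarrow> complex mat" where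
  "laplacian vs G = degree_mat vs G - adjacency_mat vs G"

text \<open>\<open>P\<close> is an invertible matrix with all entries in \<open>S\<close> such that the product of
  \<open>Q\<close>, \<open>L\<close> and \<open>P\<close> is diagonal, \<open>Q\<close> being the inverse of \<open>P\<close>.\<close>

definition S_diagonalizes :: "complex set \<Rightarrow> complex mat \<Rightarrow> complex mat \<Rightarrow> bool" where
  "S_diagonalizes S P L \<longleftrightarrow>
     P \<in> carrier_mat (dim_row L) (dim_row L) \<and> elements_mat P \<subseteq> S \<and>
     (\<exists>Q \<in> carrier_mat (dim_row L) (dim_row L).
        inverts_mat P Q \<and> inverts_mat Q P \<and> diagonal_mat (Q * L * P))"

definition S_diagonalizable :: "complex set \<Rightarrow> 'a list \<Rightarrow> 'a pair_pre_digraph \<Rightarrow> bool" where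
  "S_diagonalizable S vs G \<longleftrightarrow> (\<exists>P. S_diagonalizes S P (laplacian vs G))"

definition bandwidth :: "complex mat \<Rightarrow> nat" where
  "bandwidth M = (LEAST k. 0 < k \<and>
     (\<forall>i < dim_row M. \<forall>j < dim_col M. int k \<le> \<bar>int i - int j\<bar> \<longrightarrow> M $$ (i, j) = 0))"

definition S_bandwidth :: "complex set \<Rightarrow> 'a list \<Rightarrow> 'a pair_pre_digraph \<Rightarrow> enat" where
  "S_bandwidth S vs G =
     (if S_diagonalizable S vs G
      then enat (LEAST k. 0 < k \<and>
        (\<exists>P. S_diagonalizes S P (laplacian vs G) \<and> bandwidth (P\<^sup>T * P) = k))
      else \<infinity>)"

text \<open>The notion is only meaningful for vectors of positive dimension \<open>p\<close>; the null space and the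
  span are taken over all complex numbers.\<close>

definition S_balanced :: "complex set \<Rightarrow> complex vec \<Rightarrow> bool" where
  "S_balanced S v \<longleftrightarrow> (let p = dim_vec v in
     (p = 1 \<and> v \<noteq> 0\<^sub>v p) \<or>
     (p \<ge> 2 \<and> (\<exists>M \<in> carrier_mat (p - 1) p. elements_mat M \<subseteq> S \<and>
        mat_kernel M = module.span class_ring (module_vec TYPE(complex) p) {v})))"

end

theory Submission
  imports Defs "Jordan_Normal_Form.Determinant"
begin

text \<open>The kernel of \<open>L\<close> consists of the vectors that are constant on components, and all eigenvectors
  of nonzero eigenvalue are orthogonal to it. Since \<open>L\<^sup>c = n I - J - L\<close>, the eigenvectors of \<open>L\<close> for
  nonzero eigenvalues stay eigenvectors of \<open>L\<^sup>c\<close>, and the eigenspace of \<open>L\<^sup>c\<close> for \<open>n\<close> is the set of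
  lifts to the vertices of the vectors \<open>y\<close> in \<open>\<complex>\<^sup>p\<close> with \<open>v \<bullet> y = 0\<close>. An eigenbasis of
  \<open>L\<^sup>c\<close> with entries in \<open>S\<close> therefore contains exactly \<open>p - 1\<close> such lifts, which are the rows
  of a matrix with kernel spanned by \<open>v\<close>. Conversely, the kernel columns in an eigenbasis of \<open>L\<close> can be
  exchanged for the lifted rows of such a matrix and a constant vector. The exchanged columns are
  orthogonal to all the others and the constant one is orthogonal to the lifted rows, so only the block
  of \<open>p - 1\<close> lifted rows can increase the bandwidth.\<close>

section \<open>Linearly independent families of functions\<close>

text \<open>Independence of an indexed family rather than of a set of vectors, so that equal members
  at different indices count as dependent. Functions on an arbitrary \<open>I\<close> serve for
  vertices, components and matrix rows alike.\<close>

definition indep_family :: "'i set \<Rightarrow> 'j set \<Rightarrow> ('j \<Rightarrow> 'i \<Rightarrow> 'f::field) \<Rightarrow> bool" where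
  "indep_family I J w \<longleftrightarrow> (\<forall>x. (\<forall>i\<in>I. (\<Sum>j\<in>J. x j * w j i) = 0) \<longrightarrow> (\<forall>j\<in>J. x j = 0))"

lemma indep_familyD:
  "indep_family I J w \<Longrightarrow> (\<And>i. i \<in> I \<Longrightarrow> (\<Sum>j\<in>J. x j * w j i) = 0) \<Longrightarrow> j \<in> J \<Longrightarrow> x j = 0"
  unfolding indep_family_def by blast

lemma indep_family_iff_det:
  fixes A :: "'f::field mat"
  assumes "A \<in> carrier_mat n n"
  shows "indep_family {..<n} {..<n} (\<lambda>j i. A $$ (i, j)) \<longleftrightarrow> det A \<noteq> 0"
proof -
  have prod: "A *\<^sub>v u = 0\<^sub>v n \<longleftrightarrow> (\<forall>i<n. (\<Sum>j<n. u $ j * A $$ (i, j)) = 0)" if "u \<in> carrier_vec n" for u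
    using assms that
    by (auto simp: vec_eq_iff scalar_prod_def atLeast0LessThan mult.commute)
  show ?thesis
  proof
    assume ind: "indep_family {..<n} {..<n} (\<lambda>j i. A $$ (i, j))"
    show "det A \<noteq> 0"
    proof
      assume "det A = 0"
      then obtain u where u: "u \<in> carrier_vec n" "u \<noteq> 0\<^sub>v n" "A *\<^sub>v u = 0\<^sub>v n"
        using det_0_iff_vec_prod_zero[OF assms] by blast
      have "u $ j = 0" if "j < n" for j
        using indep_familyD[OF ind, of "($) u" j] prod[OF u(1)] u(3) that by simp
      then show False using u(1,2) by auto
    qed
  next
    assume det: "det A \<noteq> 0"
    show "indep_family {..<n} {..<n} (\<lambda>j i. A $$ (i, j))"
      unfolding indep_family_def
    proof (intro allI impI ballI)
      fix x :: "nat \<Rightarrow> 'f" and j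
      assume x: "\<forall>i\<in>{..<n}. (\<Sum>j<n. x j * A $$ (i, j)) = 0" and j: "j \<in> {..<n}"
      have "A *\<^sub>v vec n x = 0\<^sub>v n" using x by (subst prod) auto
      then have "vec n x = 0\<^sub>v n" using det det_0_iff_vec_prod_zero[OF assms] by force
      then show "x j = 0" using j by (metis index_vec index_zero_vec(1) lessThan_iff)
    qed
  qed
qed

lemma indep_family_reindex:
  assumes "finite J" and ind: "indep_family I J w" and g: "inj_on g J'" "g ` J' \<subseteq> J"
  shows "indep_family I J' (\<lambda>j. w (g j))"
  unfolding indep_family_def
proof (intro allI impI ballI)
  fix x j
  assume x: "\<forall>i\<in>I. (\<Sum>j\<in>J'. x j * w (g j) i) = 0" and j: "j \<in> J'"
  \<comment> \<open>The coefficients are carried along \<open>g\<close> and set to 0 off its image,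
    which turns a relation over \<open>J'\<close> into one over \<open>J\<close>.\<close>
  define x' where "x' b = (if b \<in> g ` J' then x (the_inv_into J' g b) else 0)" for b
  have x': "x' (g j) = x j" if "j \<in> J'" for j
    using that g(1) by (simp add: x'_def the_inv_into_f_f)
  have "(\<Sum>b\<in>J. x' b * w b i) = 0" if "i \<in> I" for i
  proof -
    have "(\<Sum>b\<in>J. x' b * w b i) = (\<Sum>b\<in>g ` J'. x' b * w b i)"
      using assms(1) g(2) by (intro sum.mono_neutral_right) (auto simp: x'_def)
    also have "\<dots> = (\<Sum>j\<in>J'. x j * w (g j) i)"
      using g(1) by (simp add: sum.reindex x')
    finally show ?thesis using x that by simp
  qed
  moreover have "g j \<in> J" using g(2) j by blast
  ultimately have "x' (g j) = 0" by (rule indep_familyD[OF ind])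
  then show "x j = 0" using x' j by simp
qed

text \<open>A family larger than \<open>I\<close> becomes a square matrix once zero rows are added.
  Its determinant is 0, which contradicts the independence of its columns.\<close>

lemma indep_family_card_le:
  fixes w :: "'j \<Rightarrow> 'i \<Rightarrow> 'f::field"
  assumes fin: "finite I" "finite J" and ind: "indep_family I J w"
  shows "card J \<le> card I"
proof (rule ccontr)
  assume "\<not> card J \<le> card I"
  define m where "m = card J"
  have lt: "card I < m" using \<open>\<not> _\<close> by (simp add: m_def)
  obtain f where f: "bij_betw f {..<card I} I"
    using ex_bij_betw_nat_finite[OF fin(1)] by (auto simp: atLeast0LessThan)
  obtain g where g: "bij_betw g {..<m} J"
    using ex_bij_betw_nat_finite[OF fin(2)] by (auto simp: atLeast0LessThan m_def)
  have ind': "indep_family I {..<m} (\<lambda>c. w (g c))"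
    using g by (intro indep_family_reindex[OF fin(2) ind]) (auto simp: bij_betw_def)
  define A where "A = mat m m (\<lambda>(r, c). if r < card I then w (g c) (f r) else 0)"
  have A: "A \<in> carrier_mat m m" by (simp add: A_def)
  \<comment> \<open>Row \<open>card I\<close> is the first of the added zero rows, so the transpose
    kills the corresponding unit vector.\<close>
  have "\<exists>a. a \<in> carrier_vec m \<and> a \<noteq> 0\<^sub>v m \<and> A\<^sup>T *\<^sub>v a = 0\<^sub>v m"
    using lt
    by (intro exI[of _ "unit_vec m (card I)"])
       (auto simp: A_def vec_eq_iff scalar_prod_def unit_vec_def if_distrib cong: if_cong)
  then have "det A\<^sup>T = 0" using A by (subst det_0_iff_vec_prod_zero[of _ m]) auto
  then have "\<not> indep_family {..<m} {..<m} (\<lambda>j i. A $$ (i, j))"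
    using indep_family_iff_det[OF A] det_transpose[OF A] by simp
  moreover have "indep_family {..<m} {..<m} (\<lambda>j i. A $$ (i, j))"
    unfolding indep_family_def
  proof (intro allI impI ballI)
    fix x :: "nat \<Rightarrow> 'f" and j
    assume x: "\<forall>i\<in>{..<m}. (\<Sum>j<m. x j * A $$ (i, j)) = 0" and j: "j \<in> {..<m}"
    have "(\<Sum>c<m. x c * w (g c) i) = 0" if i: "i \<in> I" for i
    proof -
      obtain r where r: "r < card I" "f r = i"
        using f i by (metis bij_betw_imp_surj_on imageE lessThan_iff)
      have "(\<Sum>c<m. x c * w (g c) i) = (\<Sum>c<m. x c * A $$ (r, c))"
        using r lt by (intro sum.cong) (auto simp: A_def)
      also have "\<dots> = 0" using x r lt by auto
      finally show ?thesis .
    qed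
    then show "x j = 0" using j by (rule indep_familyD[OF ind'])
  qed
  ultimately show False by blast
qed

text \<open>Adjoining \<open>x\<close> makes the family too large to be independent. In a nontrivial
  relation the coefficient of \<open>x\<close> cannot be 0, so the relation can be solved for
  \<open>x\<close>.\<close>

lemma indep_family_spans:
  fixes w :: "'j \<Rightarrow> 'i \<Rightarrow> 'f::field"
  assumes fin: "finite I" "finite J" and card: "card J = card I" and ind: "indep_family I J w"
  obtains a where "\<And>i. i \<in> I \<Longrightarrow> x i = (\<Sum>j\<in>J. a j * w j i)"
proof -
  \<comment> \<open>The index \<open>None\<close> stands for \<open>x\<close>.\<close>
  define J' where "J' = insert None (Some ` J)"
  define w' where "w' = case_option x w"
  have sum': "(\<Sum>j\<in>J'. b j * w' j i) = b None * x i + (\<Sum>j\<in>J. b (Some j) * w j i)" for b i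
    using fin by (simp add: J'_def w'_def sum.reindex)
  have "card J' = Suc (card J)" using fin by (simp add: J'_def card_image)
  then have "\<not> indep_family I J' w'"
    using indep_family_card_le[of I J' w'] fin card by (auto simp: J'_def)
  then obtain b where "\<forall>i\<in>I. (\<Sum>j\<in>J'. b j * w' j i) = 0" and b2: "\<exists>j\<in>J'. b j \<noteq> 0"
    unfolding indep_family_def by blast
  then have b1: "b None * x i + (\<Sum>j\<in>J. b (Some j) * w j i) = 0" if "i \<in> I" for i
    using sum'[of b i] that by simp
  have b0: "b None \<noteq> 0"
  proof
    assume "b None = 0"
    then have "(\<Sum>j\<in>J. b (Some j) * w j i) = 0" if "i \<in> I" for i
      using b1[OF that] by simp
    then have "b (Some j) = 0" if "j \<in> J" for j
      using indep_familyD[OF ind, of "\<lambda>j. b (Some j)", OF _ that] by blast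
    then show False using b2 \<open>b None = 0\<close> by (auto simp: J'_def)
  qed
  have "x i = (\<Sum>j\<in>J. - b (Some j) / b None * w j i)" if "i \<in> I" for i
  proof -
    have "(\<Sum>j\<in>J. - b (Some j) / b None * w j i) = - (\<Sum>j\<in>J. b (Some j) * w j i) / b None"
      by (simp add: sum_negf sum_divide_distrib)
    also have "\<dots> = x i" using b1[OF that] b0 by (simp add: field_simps) (metis add.inverse_unique add.commute)
    finally show ?thesis by simp
  qed
  then show thesis by (rule that)
qed

text \<open>A \<open>z\<close> that annihilates every member annihilates their span, hence the
  indicator function of each point \<open>k\<close>, on which it takes the value
  \<open>z k\<close>.\<close>

lemma indep_family_transposeI:
  fixes w :: "'j \<Rightarrow> 'i \<Rightarrow> 'f::field"
  assumes fin: "finite I"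
    and spans: "\<And>x. \<exists>a. \<forall>i\<in>I. x i = (\<Sum>j\<in>J. a j * w j i)"
  shows "indep_family J I (\<lambda>i j. w j i)"
  unfolding indep_family_def
proof (intro allI impI ballI)
  fix z :: "'i \<Rightarrow> 'f" and k
  assume z: "\<forall>j\<in>J. (\<Sum>i\<in>I. z i * w j i) = 0" and k: "k \<in> I"
  obtain a where a: "\<forall>i\<in>I. of_bool (i = k) = (\<Sum>j\<in>J. a j * w j i)"
    using spans[of "\<lambda>i. of_bool (i = k)"] by blast
  have "z k = (\<Sum>i\<in>I. z i * of_bool (i = k))" using fin k by simp
  also have "\<dots> = (\<Sum>i\<in>I. \<Sum>j\<in>J. a j * (z i * w j i))"
    using a by (intro sum.cong) (auto simp: sum_distrib_left mult_ac)
  also have "\<dots> = (\<Sum>j\<in>J. a j * (\<Sum>i\<in>I. z i * w j i))"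
    by (subst sum.swap) (simp add: sum_distrib_left)
  also have "\<dots> = 0" using z by simp
  finally show "z k = 0" .
qed

lemma indep_family_transpose:
  assumes "finite I" "finite J" "card J = card I" "indep_family I J w"
  shows "indep_family J I (\<lambda>i j. w j i)"
  by (rule indep_family_transposeI[OF assms(1)]) (metis indep_family_spans[OF assms])

section \<open>The Laplacian as an operator\<close>

text \<open>Row \<open>i\<close> of \<open>D - A\<close> applied to \<open>x\<close>: the degree is
  distributed over the neighbours as differences, so no matrix or degree appears.\<close>

definition laplace_op :: "'a set \<Rightarrow> 'a rel \<Rightarrow> ('a \<Rightarrow> 'f::field) \<Rightarrow> 'a \<Rightarrow> 'f" where
  "laplace_op V E x i = (\<Sum>k\<in>V. if (i, k) \<in> E then x i - x k else 0)"

text \<open>The diagonal terms agree on both sides and the rest is symmetric under exchanging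
  \<open>i\<close> and \<open>k\<close>. The form carries no conjugation, like the plain transpose
  in \<open>P\<^sup>T * P\<close>.\<close>

lemma laplace_op_self_adjoint:
  assumes "sym E"
  shows "(\<Sum>i\<in>V. y i * laplace_op V E x i) = (\<Sum>i\<in>V. laplace_op V E y i * x i)"
proof -
  let ?e = "\<lambda>i k. of_bool ((i, k) \<in> E)"
  have e: "?e i k = ?e k i" for i k using assms by (auto dest: symD)
  have "(\<Sum>i\<in>V. y i * laplace_op V E x i) - (\<Sum>i\<in>V. laplace_op V E y i * x i)
      = (\<Sum>i\<in>V. \<Sum>k\<in>V. ?e i k * (y k * x i) - ?e i k * (y i * x k))"
    unfolding laplace_op_def sum_distrib_left sum_distrib_right sum_subtractf[symmetric]
    by (intro sum.cong refl) (auto simp: algebra_simps)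
  also have "\<dots> = (\<Sum>i\<in>V. \<Sum>k\<in>V. ?e i k * (y k * x i)) - (\<Sum>i\<in>V. \<Sum>k\<in>V. ?e i k * (y i * x k))"
    by (simp only: sum_subtractf)
  also have "(\<Sum>i\<in>V. \<Sum>k\<in>V. ?e i k * (y i * x k)) = (\<Sum>k\<in>V. \<Sum>i\<in>V. ?e k i * (y i * x k))"
    by (subst sum.swap) (simp only: e)
  finally show ?thesis by simp
qed

lemma laplace_op_complement:
  assumes "finite V" "i \<in> V" "irrefl E"
    and compl: "\<And>k. k \<in> V \<Longrightarrow> (i, k) \<in> F \<longleftrightarrow> i \<noteq> k \<and> (i, k) \<notin> E"
  shows "laplace_op V F x i = of_nat (card V) * x i - sum x V - laplace_op V E x i"
proof -
  \<comment> \<open>The two graphs together form the complete graph; the term \<open>k = i\<close>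
    contributes 0.\<close>
  have "laplace_op V F x i + laplace_op V E x i = (\<Sum>k\<in>V. x i - x k)"
    unfolding laplace_op_def sum.distrib[symmetric]
    using compl by (intro sum.cong) auto
  then show ?thesis by (simp add: sum_subtractf algebra_simps)
qed

text \<open>Pairing \<open>L x = 0\<close> with the conjugate of \<open>x\<close> yields half the
  energy, the sum of the squares of \<open>cmod (x i - x k)\<close> over all arcs. It vanishes,
  hence so does each of its nonnegative terms.\<close>

lemma laplace_op_kernel_adjacent:
  fixes x :: "'a \<Rightarrow> complex"
  assumes "sym E" and fin: "finite V" and ker: "\<And>i. i \<in> V \<Longrightarrow> laplace_op V E x i = 0"
    and ik: "i \<in> V" "k \<in> V" "(i, k) \<in> E"
  shows "x i = x k"
proof -
  let ?e = "\<lambda>i k. of_bool ((i, k) \<in> E) :: complex"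
  let ?q = "\<lambda>i k. of_bool ((i, k) \<in> E) * (cmod (x i - x k))\<^sup>2"
  have e: "?e i k = ?e k i" for i k using assms(1) by (auto dest: symD)
  have 0: "(\<Sum>i\<in>V. \<Sum>k\<in>V. ?e i k * (cnj (x i) * (x i - x k))) = 0"
  proof -
    have "(\<Sum>i\<in>V. \<Sum>k\<in>V. ?e i k * (cnj (x i) * (x i - x k)))
        = (\<Sum>i\<in>V. cnj (x i) * laplace_op V E x i)"
      unfolding laplace_op_def sum_distrib_left by (intro sum.cong) auto
    then show ?thesis using ker by simp
  qed
  \<comment> \<open>Each square splits into two terms that are interchanged by swapping
    \<open>i\<close> and \<open>k\<close>, so both double sums are 0.\<close>
  have "complex_of_real (\<Sum>i\<in>V. \<Sum>k\<in>V. ?q i k)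
      = (\<Sum>i\<in>V. \<Sum>k\<in>V. ?e i k * (cnj (x i) * (x i - x k)) + ?e i k * (cnj (x k) * (x k - x i)))"
    unfolding of_real_sum
    by (intro sum.cong refl) (simp add: complex_norm_square algebra_simps del: of_real_power)
  also have "\<dots> = (\<Sum>i\<in>V. \<Sum>k\<in>V. ?e i k * (cnj (x k) * (x k - x i)))"
    using 0 by (simp only: sum.distrib add_0)
  also have "\<dots> = (\<Sum>k\<in>V. \<Sum>i\<in>V. ?e k i * (cnj (x k) * (x k - x i)))"
    by (subst sum.swap) (simp only: e)
  also have "\<dots> = 0" by (rule 0)
  finally have "(\<Sum>i\<in>V. \<Sum>k\<in>V. ?q i k) = 0" by (simp only: of_real_eq_0_iff)
  then have "?q i k = 0"
    using fin ik(1,2) by (simp add: sum_nonneg_eq_0_iff sum_nonneg del: mult_eq_0_iff)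
  then show ?thesis using ik(3) by simp
qed

text \<open>The constant function lies in the kernel, so self-adjointness makes it orthogonal to
  every eigenvector of nonzero eigenvalue.\<close>

lemma laplace_op_eigenvector_sum:
  fixes x :: "'a \<Rightarrow> 'f::field"
  assumes "sym E" and eig: "\<And>i. i \<in> V \<Longrightarrow> laplace_op V E x i = d * x i" and "d \<noteq> 0"
  shows "sum x V = 0"
proof -
  have "d * sum x V = (\<Sum>i\<in>V. 1 * laplace_op V E x i)"
    using eig by (simp add: sum_distrib_left)
  also have "\<dots> = (\<Sum>i\<in>V. laplace_op V E (\<lambda>_. 1) i * x i)"
    by (rule laplace_op_self_adjoint[OF assms(1)])
  also have "\<dots> = 0" by (simp add: laplace_op_def)
  finally show ?thesis using assms(3) by simp
qed

text \<open>\<open>\<kappa>\<close> numbers the connected components of the graph.\<close>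

locale laplace_kernel =
  fixes V :: "'a set" and E :: "'a rel" and \<kappa> :: "'a \<Rightarrow> nat" and p :: nat
  assumes finite_V: "finite V" and sym_E: "sym E" and irrefl_E: "irrefl E"
    and \<kappa>_onto: "\<kappa> ` V = {..<p}" and nonempty: "V \<noteq> {}"
    and \<kappa>_adjacent: "\<And>i k. i \<in> V \<Longrightarrow> k \<in> V \<Longrightarrow> (i, k) \<in> E \<Longrightarrow> \<kappa> i = \<kappa> k"
    and kernel_const: "\<And>(x :: 'a \<Rightarrow> complex) i k. (\<And>i. i \<in> V \<Longrightarrow> laplace_op V E x i = 0) \<Longrightarrow>
        i \<in> V \<Longrightarrow> k \<in> V \<Longrightarrow> \<kappa> i = \<kappa> k \<Longrightarrow> x i = x k"
begin

definition \<nu> :: "nat \<Rightarrow> complex" where "\<nu> c = of_nat (card {i \<in> V. \<kappa> i = c})"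

text \<open>A section of \<open>\<kappa>\<close>, through which a function constant on components is
  read as a function of the component number. Its values are meaningful only below
  \<open>p\<close>.\<close>

definition rep :: "nat \<Rightarrow> 'a" where "rep c = (SOME i. i \<in> V \<and> \<kappa> i = c)"

lemma rep: "c < p \<Longrightarrow> rep c \<in> V" "c < p \<Longrightarrow> \<kappa> (rep c) = c"
proof -
  assume "c < p"
  then have "\<exists>i. i \<in> V \<and> \<kappa> i = c" using \<kappa>_onto by (metis imageE lessThan_iff)
  then show "rep c \<in> V" "\<kappa> (rep c) = c" unfolding rep_def by (rule someI2_ex, simp)+
qed

lemma \<kappa>_less: "i \<in> V \<Longrightarrow> \<kappa> i < p"
  using \<kappa>_onto by blast

lemma p_pos: "0 < p"
  using nonempty \<kappa>_less by fastforce

lemma \<nu>_nonzero: "c < p \<Longrightarrow> \<nu> c \<noteq> 0"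
  using rep[of c] finite_V by (auto simp: \<nu>_def)

text \<open>Grouping by component weights each value with the component size. Hence a lift is
  orthogonal to the constants exactly when \<open>y\<close> is orthogonal to
  \<open>\<nu>\<close>.\<close>

lemma sum_lift: "(\<Sum>i\<in>V. y (\<kappa> i)) = (\<Sum>c<p. \<nu> c * y c)"
proof -
  have "(\<Sum>i\<in>V. y (\<kappa> i)) = (\<Sum>c<p. \<Sum>i\<in>{i\<in>V. \<kappa> i = c}. y (\<kappa> i))"
    using finite_V \<kappa>_less by (intro sum.group[symmetric]) auto
  also have "\<dots> = (\<Sum>c<p. \<nu> c * y c)" by (intro sum.cong) (auto simp: \<nu>_def)
  finally show ?thesis .
qed

lemma sum_\<nu>: "(\<Sum>c<p. \<nu> c) = of_nat (card V)"
  using sum_lift[of "\<lambda>_. 1"] by simp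

lemma card_V_nonzero: "(of_nat (card V) :: complex) \<noteq> 0"
  using nonempty finite_V by simp

lemma laplace_op_lift:
  assumes "i \<in> V"
  shows "laplace_op V E (\<lambda>i. y (\<kappa> i)) i = (0 :: complex)"
  unfolding laplace_op_def using \<kappa>_adjacent[OF assms] by (intro sum.neutral) auto

lemma kernel_eq_lift:
  assumes "\<And>i. i \<in> V \<Longrightarrow> laplace_op V E (x :: 'a \<Rightarrow> complex) i = 0" "i \<in> V"
  shows "x i = x (rep (\<kappa> i))"
  using kernel_const[OF assms(1,2), of "rep (\<kappa> i)"] rep \<kappa>_less[OF assms(2)] assms(2) by simp

text \<open>Lifts are kernel vectors, and self-adjointness separates the kernel from the other
  eigenspaces.\<close>

lemma orthogonal_lift:
  assumes eig: "\<And>i. i \<in> V \<Longrightarrow> laplace_op V E x i = d * x i" and "d \<noteq> 0"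
  shows "(\<Sum>i\<in>V. x i * y (\<kappa> i)) = (0 :: complex)"
proof -
  have "d * (\<Sum>i\<in>V. x i * y (\<kappa> i)) = (\<Sum>i\<in>V. laplace_op V E x i * y (\<kappa> i))"
    using eig by (simp add: sum_distrib_left mult.assoc)
  also have "\<dots> = 0"
    unfolding laplace_op_self_adjoint[OF sym_E, symmetric] using laplace_op_lift by simp
  finally show ?thesis using \<open>d \<noteq> 0\<close> by simp
qed

end

text \<open>Expand \<open>x\<close> in the eigenbasis and apply the operator: comparing coefficients
  leaves \<open>a j * (d j - e) = 0\<close>, so only members of eigenvalue \<open>e\<close>
  occur.\<close>

lemma laplace_op_eigenvector_expansion:
  fixes x :: "'a \<Rightarrow> 'f::field"
  assumes fin: "finite V" "finite J" and card: "card J = card V" and ind: "indep_family V J w"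
    and eig: "\<And>i j. i \<in> V \<Longrightarrow> j \<in> J \<Longrightarrow> laplace_op V E (w j) i = d j * w j i"
    and x: "\<And>i. i \<in> V \<Longrightarrow> laplace_op V E x i = e * x i"
  obtains a where "\<And>i. i \<in> V \<Longrightarrow> x i = (\<Sum>j | j \<in> J \<and> d j = e. a j * w j i)"
proof -
  obtain a where a: "\<And>i. i \<in> V \<Longrightarrow> x i = (\<Sum>j\<in>J. a j * w j i)"
    using indep_family_spans[OF fin card ind] by blast
  have "(\<Sum>j\<in>J. a j * (d j - e) * w j i) = 0" if i: "i \<in> V" for i
  proof -
    have "laplace_op V E x i = (\<Sum>k\<in>V. if (i, k) \<in> E then (\<Sum>j\<in>J. a j * (w j i - w j k)) else 0)"
      unfolding laplace_op_def using a i
      by (intro sum.cong) (auto simp: sum_subtractf right_diff_distrib)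
    also have "\<dots> = (\<Sum>k\<in>V. \<Sum>j\<in>J. a j * (if (i, k) \<in> E then w j i - w j k else 0))"
      by (intro sum.cong) auto
    also have "\<dots> = (\<Sum>j\<in>J. a j * laplace_op V E (w j) i)"
      by (subst sum.swap) (simp add: laplace_op_def sum_distrib_left)
    finally have "laplace_op V E x i = (\<Sum>j\<in>J. a j * (d j * w j i))"
      using eig i by simp
    then have "(\<Sum>j\<in>J. a j * (d j * w j i)) = (\<Sum>j\<in>J. e * (a j * w j i))"
      using x a i by (simp add: sum_distrib_left)
    then show ?thesis by (simp add: algebra_simps sum_subtractf)
  qed
  then have "a j * (d j - e) = 0" if "j \<in> J" for j
    using indep_familyD[OF ind, of "\<lambda>j. a j * (d j - e)", OF _ that] by blast
  then have "x i = (\<Sum>j | j \<in> J \<and> d j = e. a j * w j i)" if "i \<in> V" for i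
    unfolding a[OF that] using fin by (intro sum.mono_neutral_right) auto
  then show thesis by (rule that)
qed

text \<open>Columns picked in increasing order are at least as far apart in the old order as in the
  new one, so the zeros outside the old band are inherited.\<close>

lemma sorted_wrt_less_nth_diff:
  fixes xs :: "nat list"
  assumes "sorted_wrt (<) xs" "a \<le> b" "b < length xs"
  shows "b - a \<le> xs ! b - xs ! a"
  using assms(2,3)
proof (induction b rule: dec_induct)
  case base
  then show ?case by simp
next
  case (step b)
  have "xs ! b < xs ! Suc b" "a = b \<or> xs ! a < xs ! b"
    using assms(1) step by (auto simp: sorted_wrt_iff_nth_less)
  then show ?case using step by auto
qed

section \<open>Eigenbases of the complement and balanced rows\<close>

context laplace_kernel
begin

text \<open>Balancedness of \<open>\<nu>\<close> in terms of functions, apart from membership in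
  \<open>S\<close>. For \<open>p = 1\<close> there are no rows and the condition holds because
  \<open>\<nu> 0\<close> is nonzero, in accordance with the convention for dimension one.\<close>

definition balanced_rows :: "(nat \<Rightarrow> nat \<Rightarrow> complex) \<Rightarrow> bool" where
  "balanced_rows M \<longleftrightarrow> (\<forall>z. (\<forall>r<p - 1. (\<Sum>c<p. M r c * z c) = 0) \<longleftrightarrow> (\<exists>t. \<forall>c<p. z c = t * \<nu> c))"

definition complement_arcs :: "'a rel" where
  "complement_arcs = {(i, k). i \<in> V \<and> k \<in> V \<and> i \<noteq> k \<and> (i, k) \<notin> E}"

lemma sym_complement_arcs: "sym complement_arcs"
  using sym_E by (auto simp: complement_arcs_def sym_def)

lemma laplace_op_complement_arcs:
  "i \<in> V \<Longrightarrow> laplace_op V complement_arcs x i = of_nat (card V) * x i - sum x V - laplace_op V E x i"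
  using finite_V irrefl_E by (intro laplace_op_complement) (auto simp: complement_arcs_def)

lemma indep_family_rep:
  assumes "indep_family V K w"
    and const: "\<And>i j. i \<in> V \<Longrightarrow> j \<in> K \<Longrightarrow> w j i = w j (rep (\<kappa> i))"
  shows "indep_family {..<p} K (\<lambda>j c. w j (rep c))"
  unfolding indep_family_def
proof (intro allI impI)
  fix x assume x: "\<forall>c\<in>{..<p}. (\<Sum>j\<in>K. x j * w j (rep c)) = 0"
  have "(\<Sum>j\<in>K. x j * w j i) = 0" if "i \<in> V" for i
  proof -
    have "(\<Sum>j\<in>K. x j * w j i) = (\<Sum>j\<in>K. x j * w j (rep (\<kappa> i)))"
      using const[OF that] by simp
    then show ?thesis using x \<kappa>_less[OF that] by simp
  qed
  then show "\<forall>j\<in>K. x j = 0" using assms(1) unfolding indep_family_def by blast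
qed

text \<open>Restricted to representatives, the members of eigenvalue 0 are independent in dimension
  \<open>p\<close>. They also span it, since every lift is a kernel vector and expands in them. The
  two facts bound the count from both sides.\<close>

lemma card_kernel_family:
  fixes w :: "'j \<Rightarrow> 'a \<Rightarrow> complex"
  assumes J: "finite J" "card J = card V" and ind: "indep_family V J w"
    and eig: "\<And>i j. i \<in> V \<Longrightarrow> j \<in> J \<Longrightarrow> laplace_op V E (w j) i = d j * w j i"
  shows "card {j \<in> J. d j = 0} = p"
proof -
  let ?Z = "{j \<in> J. d j = 0}"
  have fin: "finite ?Z" using J by simp
  have const: "w j i = w j (rep (\<kappa> i))" if "i \<in> V" "j \<in> ?Z" for i j
    using that eig by (intro kernel_eq_lift[of "w j"]) auto
  have "indep_family V ?Z w"
    using indep_family_reindex[OF J(1) ind, of id ?Z] by simp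
  then have "indep_family {..<p} ?Z (\<lambda>j c. w j (rep c))"
    using const by (rule indep_family_rep)
  then have "card ?Z \<le> p" using indep_family_card_le[OF _ fin] by fastforce
  moreover have "indep_family ?Z {..<p} (\<lambda>c j. w j (rep c))"
  proof (rule indep_family_transposeI)
    fix y :: "nat \<Rightarrow> complex"
    obtain a where a: "\<And>i. i \<in> V \<Longrightarrow> y (\<kappa> i) = (\<Sum>j\<in>?Z. a j * w j i)"
      using laplace_op_eigenvector_expansion[OF finite_V J ind eig, of "\<lambda>i. y (\<kappa> i)" 0]
        laplace_op_lift[of _ y] by auto
    have "y c = (\<Sum>j\<in>?Z. a j * w j (rep c))" if "c < p" for c
      using rep[OF that] a[of "rep c"] by simp
    then show "\<exists>a. \<forall>c\<in>{..<p}. y c = (\<Sum>j\<in>?Z. a j * w j (rep c))" by auto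
  qed simp
  then have "p \<le> card ?Z" using indep_family_card_le[OF fin] by fastforce
  ultimately show ?thesis by simp
qed

text \<open>The rows are the eigenvectors of eigenvalue \<open>card V\<close>, read at the
  representatives. They span the orthogonal complement of \<open>\<nu>\<close>, whose own orthogonal
  complement is the line through \<open>\<nu>\<close>.\<close>

lemma balanced_rows_if_complement_arcs_eigenbasis:
  fixes w :: "'j \<Rightarrow> 'a \<Rightarrow> complex"
  assumes J: "finite J" "card J = card V" and ind: "indep_family V J w"
    and eig: "\<And>i j. i \<in> V \<Longrightarrow> j \<in> J \<Longrightarrow> laplace_op V complement_arcs (w j) i = e j * w j i"
    and S: "\<And>i j. i \<in> V \<Longrightarrow> j \<in> J \<Longrightarrow> w j i \<in> S"
  shows "\<exists>M. (\<forall>r<p - 1. \<forall>c<p. M r c \<in> S) \<and> balanced_rows M"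
proof -
  let ?N = "of_nat (card V) :: complex"
  define K where "K = {j \<in> J. e j = ?N}"
  define y where "y j c = w j (rep c)" for j c
  have finK: "finite K" using J by (simp add: K_def)
  have sum0: "sum (w j) V = 0" if "j \<in> K" for j
    using that eig card_V_nonzero
    by (intro laplace_op_eigenvector_sum[OF sym_complement_arcs, of V _ ?N]) (auto simp: K_def)
  \<comment> \<open>As the entries sum to 0, the complement formula turns eigenvalue
    \<open>card V\<close> into eigenvalue 0 of the original graph.\<close>
  have const: "w j i = w j (rep (\<kappa> i))" if "i \<in> V" "j \<in> K" for i j
  proof (rule kernel_eq_lift[of "w j"])
    show "laplace_op V E (w j) i = 0" if "i \<in> V" for i
      using laplace_op_complement_arcs[OF that, of "w j"] eig[OF that, of j] sum0 \<open>j \<in> K\<close>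
      by (auto simp: K_def)
  qed (rule that)
  have y\<nu>: "(\<Sum>c<p. \<nu> c * y j c) = 0" if "j \<in> K" for j
    using sum_lift[of "y j"] sum0[OF that] const[OF _ that] by (simp add: y_def)
  \<comment> \<open>Conversely, the lift of a \<open>q\<close> orthogonal to \<open>\<nu>\<close> is
    an eigenvector for \<open>card V\<close> and expands in \<open>K\<close>.\<close>
  have spans: "\<exists>a. \<forall>c<p. q c = (\<Sum>j\<in>K. a j * y j c)" if q: "(\<Sum>c<p. \<nu> c * q c) = 0" for q
  proof -
    have "laplace_op V complement_arcs (\<lambda>i. q (\<kappa> i)) i = ?N * q (\<kappa> i)" if "i \<in> V" for i
      using laplace_op_complement_arcs[OF that, of "\<lambda>i. q (\<kappa> i)"] laplace_op_lift[OF that, of q] q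
      by (simp add: sum_lift)
    then obtain a where a: "\<And>i. i \<in> V \<Longrightarrow> q (\<kappa> i) = (\<Sum>j | j \<in> J \<and> e j = ?N. a j * w j i)"
      using laplace_op_eigenvector_expansion[OF finite_V J ind eig, of "\<lambda>i. q (\<kappa> i)" ?N] by blast
    have "q c = (\<Sum>j\<in>K. a j * y j c)" if "c < p" for c
      using rep[OF that] a[of "rep c"] by (simp add: K_def y_def)
    then show ?thesis by blast
  qed
  have ker: "\<exists>t. \<forall>c<p. z c = t * \<nu> c" if z: "\<And>j. j \<in> K \<Longrightarrow> (\<Sum>c<p. y j c * z c) = 0" for z
  proof (intro exI allI impI)
    fix b assume b: "b < p"
    \<comment> \<open>This \<open>q\<close> is orthogonal to \<open>\<nu>\<close> by construction;
      pairing it with \<open>z\<close> compares the ratios of \<open>z\<close> and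
      \<open>\<nu>\<close> at \<open>b\<close> and at 0.\<close>
    define q where "q c = (if c = b then \<nu> 0 else 0) - (if c = 0 then \<nu> b else 0)" for c
    have q: "(\<Sum>c<p. f c * q c) = f b * \<nu> 0 - f 0 * \<nu> b" for f
      using b p_pos by (simp add: q_def right_diff_distrib sum_subtractf if_distrib[where f = "(*) x" for x] cong: if_cong)
    have "(\<Sum>c<p. \<nu> c * q c) = 0" by (simp add: q)
    then obtain a where a: "\<forall>c<p. q c = (\<Sum>j\<in>K. a j * y j c)" using spans by blast
    have "(\<Sum>c<p. z c * q c) = (\<Sum>c<p. \<Sum>j\<in>K. a j * (y j c * z c))"
      using a by (intro sum.cong) (auto simp: sum_distrib_left mult_ac)
    also have "\<dots> = (\<Sum>j\<in>K. a j * (\<Sum>c<p. y j c * z c))"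
      by (subst sum.swap) (simp add: sum_distrib_left)
    also have "\<dots> = 0" using z by simp
    finally have "z b * \<nu> 0 - z 0 * \<nu> b = 0" by (simp only: q)
    then show "z b = z 0 / \<nu> 0 * \<nu> b"
      using \<nu>_nonzero[OF p_pos] by (simp add: field_simps)
  qed
  \<comment> \<open>The constant function 1, indexed by \<open>None\<close>, is not orthogonal to
    \<open>\<nu>\<close>. It completes the rows to a basis in dimension \<open>p\<close>, so there
    are \<open>p - 1\<close> of them.\<close>
  define K' where "K' = insert None (Some ` K)"
  define y' where "y' = case_option (\<lambda>_. 1) y"
  have finK': "finite K'" and cardK': "card K' = Suc (card K)"
    using finK by (auto simp: K'_def card_image)
  have sum': "(\<Sum>j\<in>K'. b j * y' j c) = b None + (\<Sum>j\<in>K. b (Some j) * y j c)" for b c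
    using finK by (simp add: K'_def y'_def sum.reindex)
  have indK: "indep_family {..<p} K y"
    unfolding y_def
    using indep_family_rep[of K w] const indep_family_reindex[OF J(1) ind, of id K]
    by (simp add: K_def)
  have "indep_family {..<p} K' y'"
    unfolding indep_family_def sum'
  proof (intro allI impI ballI)
    fix b j assume b: "\<forall>c\<in>{..<p}. b None + (\<Sum>j\<in>K. b (Some j) * y j c) = 0" and j: "j \<in> K'"
    \<comment> \<open>Pairing a relation with \<open>\<nu>\<close> cancels all rows and isolates the
      coefficient of the constant.\<close>
    have "(\<Sum>c<p. \<Sum>j\<in>K. b (Some j) * (\<nu> c * y j c)) = (\<Sum>j\<in>K. b (Some j) * (\<Sum>c<p. \<nu> c * y j c))"
      by (subst sum.swap) (simp add: sum_distrib_left)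
    then have "?N * b None = (\<Sum>c<p. \<nu> c * (b None + (\<Sum>j\<in>K. b (Some j) * y j c)))"
      by (simp add: y\<nu> distrib_left sum.distrib sum_distrib_left mult.left_commute
        flip: sum_distrib_right sum_\<nu>)
    also have "\<dots> = 0" using b by simp
    finally have b0: "b None = 0" using card_V_nonzero by simp
    have "b (Some j) = 0" if "j \<in> K" for j
      using indep_familyD[OF indK, of "\<lambda>j. b (Some j)", OF _ that] b b0 by simp
    then show "b j = 0" using b0 j by (auto simp: K'_def)
  qed
  then have "Suc (card K) \<le> p"
    using indep_family_card_le[of "{..<p}" K'] finK' cardK' by fastforce
  moreover have "indep_family K' {..<p} (\<lambda>c j. y' j c)"
    unfolding indep_family_def
  proof (intro allI impI)
    fix z assume z: "\<forall>j\<in>K'. (\<Sum>c<p. z c * y' j c) = 0"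
    then have z1: "(\<Sum>c<p. z c) = 0" and "\<And>j. j \<in> K \<Longrightarrow> (\<Sum>c<p. y j c * z c) = 0"
      by (auto simp: K'_def y'_def mult.commute)
    then obtain t where t: "\<forall>c<p. z c = t * \<nu> c" using ker by blast
    then have "t * ?N = 0" using z1 by (simp flip: sum_distrib_left sum_\<nu>)
    then show "\<forall>c\<in>{..<p}. z c = 0" using t card_V_nonzero by simp
  qed
  then have "p \<le> Suc (card K)"
    using indep_family_card_le[of K' "{..<p}"] finK' cardK' by fastforce
  ultimately have cardK: "card K = p - 1" by simp
  obtain g where g: "bij_betw g {..<p - 1} K"
    using ex_bij_betw_nat_finite[OF finK] cardK by (auto simp: atLeast0LessThan)
  then have gK: "K = g ` {..<p - 1}" by (simp add: bij_betw_def)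
  show ?thesis
  proof (intro exI[of _ "\<lambda>r. y (g r)"] conjI)
    show "\<forall>r<p - 1. \<forall>c<p. y (g r) c \<in> S"
    proof (intro allI impI)
      fix r c assume "r < p - 1" "c < p"
      then have "g r \<in> J" using gK by (auto simp: K_def)
      then show "y (g r) c \<in> S" using S rep(1) \<open>c < p\<close> by (simp add: y_def)
    qed
    show "balanced_rows (\<lambda>r. y (g r))"
      unfolding balanced_rows_def
    proof (rule allI, rule iffI)
      fix z assume "\<forall>r<p - 1. (\<Sum>c<p. y (g r) c * z c) = 0"
      then have "(\<Sum>c<p. y j c * z c) = 0" if "j \<in> K" for j using that gK by auto
      then show "\<exists>t. \<forall>c<p. z c = t * \<nu> c" by (rule ker)
    next
      fix z assume "\<exists>t. \<forall>c<p. z c = t * \<nu> c"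
      then obtain t where "\<forall>c<p. z c = t * \<nu> c" by blast
      then have "(\<Sum>c<p. y j c * z c) = t * (\<Sum>c<p. \<nu> c * y j c)" for j
        by (simp add: sum_distrib_left mult_ac)
      then show "\<forall>r<p - 1. (\<Sum>c<p. y (g r) c * z c) = 0"
        using y\<nu> gK by auto
    qed
  qed
qed

text \<open>The columns of the new matrix: the eigenvectors of nonzero eigenvalue in their old order,
  then the rows of \<open>M\<close> lifted to the components, then a constant vector.\<close>

lemma complement_arcs_eigenbasis_if_balanced_rows:
  fixes w :: "nat \<Rightarrow> 'a \<Rightarrow> complex"
  assumes n: "n = card V" and ind: "indep_family V {..<n} w"
    and eig: "\<And>i j. i \<in> V \<Longrightarrow> j < n \<Longrightarrow> laplace_op V E (w j) i = d j * w j i"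
    and S: "\<And>i j. i \<in> V \<Longrightarrow> j < n \<Longrightarrow> w j i \<in> S"
    and MS: "\<And>r c. r < p - 1 \<Longrightarrow> c < p \<Longrightarrow> M r c \<in> S" and bal: "balanced_rows M"
  obtains w' e where "indep_family V {..<n} w'"
    and "\<And>i j. i \<in> V \<Longrightarrow> j < n \<Longrightarrow> laplace_op V complement_arcs (w' j) i = e j * w' j i"
    and "\<And>i j. i \<in> V \<Longrightarrow> j < n \<Longrightarrow> w' j i \<in> S"
    and "\<And>k a b. \<lbrakk>0 < k; \<And>a b. a \<le> b \<Longrightarrow> b < n \<Longrightarrow> k \<le> b - a \<Longrightarrow> (\<Sum>i\<in>V. w a i * w b i) = 0;
           a \<le> b; b < n; max (p - 1) k \<le> b - a\<rbrakk> \<Longrightarrow> (\<Sum>i\<in>V. w' a i * w' b i) = 0"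
proof -
  let ?N = "of_nat (card V) :: complex"
  obtain i0 where i0: "i0 \<in> V" using nonempty by blast
  \<comment> \<open>A basis whose members all vanish at \<open>i0\<close> could not express the
    constant 1. The nonzero entry supplies a constant from \<open>S\<close>, which need not contain
    1.\<close>
  have "\<exists>j<n. w j i0 \<noteq> 0"
  proof (rule ccontr)
    assume "\<not> ?thesis"
    moreover obtain a where "\<And>i. i \<in> V \<Longrightarrow> (1 :: complex) = (\<Sum>j<n. a j * w j i)"
      using indep_family_spans[OF finite_V _ _ ind, of "\<lambda>_. 1"] n by auto
    ultimately show False using i0 by fastforce
  qed
  then obtain c0 where c0: "c0 \<in> S" "c0 \<noteq> 0" using S i0 by blast
  \<comment> \<open>Row \<open>p - 1\<close>, the last one, is the constant.\<close>
  define N where "N s c = (if s < p - 1 then M s c else c0)" for s c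
  define js where "js = sorted_list_of_set {j. j < n \<and> d j \<noteq> 0}"
  define m where "m = length js"
  have set_js: "set js = {j. j < n \<and> d j \<noteq> 0}" by (simp add: js_def)
  have js: "js ! r < n" "d (js ! r) \<noteq> 0" if "r < m" for r
    using nth_mem[of r js] that set_js by (auto simp: m_def)
  have "m + p = n"
  proof -
    have "card {j \<in> {..<n}. d j = 0} = p"
      using n eig by (intro card_kernel_family[OF _ _ ind]) auto
    moreover have "m = card {j. j < n \<and> d j \<noteq> 0}" by (simp add: m_def js_def)
    moreover have "{..<n} = {j. j < n \<and> d j \<noteq> 0} \<union> {j \<in> {..<n}. d j = 0}" by auto
    then have "card {..<n} = card {j. j < n \<and> d j \<noteq> 0} + card {j \<in> {..<n}. d j = 0}"
      by (metis (lifting) card_Un_disjoint disjoint_iff finite_Un finite_lessThan mem_Collect_eq)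
    ultimately show ?thesis by simp
  qed
  define w' where "w' r = (if r < m then w (js ! r) else (\<lambda>i. N (r - m) (\<kappa> i)))" for r
  have sum_M: "(\<Sum>c<p. \<nu> c * M r c) = 0" if "r < p - 1" for r
  proof -
    have "\<exists>t. \<forall>c<p. \<nu> c = t * \<nu> c" by (rule exI[of _ 1]) simp
    then have "(\<Sum>c<p. M r c * \<nu> c) = 0" using bal that unfolding balanced_rows_def by blast
    then show ?thesis by (simp add: mult.commute)
  qed
  have eig_js: "laplace_op V E (w (js ! r)) i = d (js ! r) * w (js ! r) i" if "r < m" "i \<in> V" for r i
    using eig js that by simp
  \<comment> \<open>The first \<open>p - 1\<close> rows force a null vector of \<open>N\<close> to
    be \<open>t * \<nu>\<close>; the constant row then gives \<open>t * card V * c0 = 0\<close>.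
    Transposing passes from columns to rows.\<close>
  have indN: "indep_family {..<p} {..<p} N"
  proof (rule indep_family_transpose[of "{..<p}" "{..<p}" "\<lambda>c s. N s c"])
    show "indep_family {..<p} {..<p} (\<lambda>c s. N s c)"
      unfolding indep_family_def
    proof (intro allI impI)
      fix z assume z: "\<forall>s\<in>{..<p}. (\<Sum>c<p. z c * N s c) = 0"
      have "(\<Sum>c<p. M s c * z c) = 0" if "s < p - 1" for s
        using z[rule_format, of s] that by (simp add: N_def mult.commute)
      then obtain t where t: "\<forall>c<p. z c = t * \<nu> c" using bal unfolding balanced_rows_def by blast
      have "(\<Sum>c<p. z c * c0) = 0"
        using z[rule_format, of "p - 1"] p_pos by (simp add: N_def)
      then have "t * ?N * c0 = 0"
        using t by (simp flip: sum_distrib_left sum_distrib_right sum_\<nu>)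
      then show "\<forall>c\<in>{..<p}. z c = 0" using t c0 card_V_nonzero by simp
    qed
  qed simp_all
  have 1: "indep_family V {..<n} w'"
    unfolding indep_family_def
  proof (intro allI impI ballI)
    fix x j assume x: "\<forall>i\<in>V. (\<Sum>r<n. x r * w' r i) = 0" and j: "j \<in> {..<n}"
    \<comment> \<open>A relation splits into a part \<open>u\<close> from nonzero eigenvalues and a
      lift of \<open>y\<close>, which must cancel.\<close>
    define u where "u i = (\<Sum>r<m. x r * w (js ! r) i)" for i
    define y where "y c = (\<Sum>s<p. x (m + s) * N s c)" for c
    have uy: "u i + y (\<kappa> i) = 0" if "i \<in> V" for i
    proof -
      have "(\<Sum>r<m + p. x r * w' r i) = (\<Sum>r<m. x r * w' r i) + (\<Sum>s<p. x (m + s) * w' (m + s) i)"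
        by (induction p) (simp_all add: add.assoc)
      then show ?thesis
        using x that \<open>m + p = n\<close> by (simp add: w'_def u_def y_def)
    qed
    have y0: "y c = 0" if c: "c < p" for c
    proof -
      \<comment> \<open>Testing the sum against the indicator of component \<open>c\<close> removes
        \<open>u\<close> by orthogonality and leaves \<open>\<nu> c * y c\<close>.\<close>
      let ?\<chi> = "\<lambda>a. if a = c then 1 else (0 :: complex)"
      have "(\<Sum>i\<in>V. u i * ?\<chi> (\<kappa> i)) = (\<Sum>r<m. x r * (\<Sum>i\<in>V. w (js ! r) i * ?\<chi> (\<kappa> i)))"
        unfolding u_def sum_distrib_left sum_distrib_right
        by (subst sum.swap) (simp only: mult.assoc)
      also have "\<dots> = 0"
        using orthogonal_lift[OF eig_js js(2), of _ ?\<chi>] by (intro sum.neutral) auto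
      finally have "0 = (\<Sum>i\<in>V. u i * ?\<chi> (\<kappa> i)) + 0" by simp
      also have "\<dots> = (\<Sum>i\<in>V. (u i + y (\<kappa> i)) * ?\<chi> (\<kappa> i)) - (\<Sum>i\<in>V. y (\<kappa> i) * ?\<chi> (\<kappa> i))"
        by (simp only: distrib_right sum.distrib) simp
      also have "(\<Sum>i\<in>V. (u i + y (\<kappa> i)) * ?\<chi> (\<kappa> i)) = 0" using uy by simp
      also have "(\<Sum>i\<in>V. y (\<kappa> i) * ?\<chi> (\<kappa> i)) = \<nu> c * y c"
        using sum_lift[of "\<lambda>a. y a * ?\<chi> a"] c by (simp add: if_distrib[where f = "(*) x" for x] cong: if_cong)
      finally show ?thesis using \<nu>_nonzero[OF c] by simp
    qed
    then have xp: "x (m + s) = 0" if "s < p" for s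
      using indep_familyD[OF indN, of "\<lambda>s. x (m + s)" s] that unfolding y_def by simp
    have "indep_family V {..<m} (\<lambda>r. w (js ! r))"
      using js by (intro indep_family_reindex[OF _ ind])
        (auto simp: inj_on_def m_def js_def nth_eq_iff_index_eq)
    moreover have "u i = 0" if "i \<in> V" for i
      using uy[OF that] y0 \<kappa>_less[OF that] by simp
    ultimately have xm: "x r = 0" if "r < m" for r
      using indep_familyD[of V "{..<m}" "\<lambda>r. w (js ! r)" x r] that unfolding u_def by simp
    show "x j = 0"
    proof (cases "j < m")
      case False
      then show ?thesis using xp[of "j - m"] j \<open>m + p = n\<close> by simp
    qed (rule xm)
  qed
  \<comment> \<open>On the complement the kept columns have eigenvalue \<open>card V - d\<close>,
    the lifted rows of \<open>M\<close> have \<open>card V\<close>, and the constant column at index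
    \<open>n - 1\<close> has 0.\<close>
  have 2: "laplace_op V complement_arcs (w' r) i
      = (if r < m then ?N - d (js ! r) else if r < n - 1 then ?N else 0) * w' r i"
    if i: "i \<in> V" and r: "r < n" for i r
  proof (cases "r < m")
    case True
    then have "sum (w (js ! r)) V = 0"
      using eig_js js by (intro laplace_op_eigenvector_sum[OF sym_E]) auto
    then show ?thesis
      using True laplace_op_complement_arcs[OF i, of "w' r"] eig_js i by (simp add: w'_def left_diff_distrib)
  next
    case False
    have "r - m < p - 1 \<longleftrightarrow> r < n - 1" using False r \<open>m + p = n\<close> by auto
    then have "(\<Sum>c<p. \<nu> c * N (r - m) c) = (if r < n - 1 then 0 else ?N * c0)"
      using sum_M by (simp add: N_def flip: sum_distrib_right sum_\<nu>)
    moreover have "sum (w' r) V = (\<Sum>c<p. \<nu> c * N (r - m) c)"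
      using sum_lift[of "N (r - m)"] False by (simp add: w'_def)
    moreover have "laplace_op V E (w' r) i = 0"
      using laplace_op_lift[OF i, of "N (r - m)"] False by (simp add: w'_def)
    ultimately show ?thesis
      using False r \<open>m + p = n\<close> laplace_op_complement_arcs[OF i, of "w' r"] by (auto simp: w'_def N_def)
  qed
  have 3: "w' r i \<in> S" if "i \<in> V" "r < n" for i r
    using that js S MS c0 \<kappa>_less by (auto simp: w'_def N_def)
  \<comment> \<open>Two kept columns have only moved closer together, a kept column and a lift are
    orthogonal, and two lifts are at most \<open>p - 1\<close> apart. Since \<open>0 < k\<close>,
    diagonal entries stay out even for \<open>p = 1\<close>.\<close>
  have 4: "(\<Sum>i\<in>V. w' a i * w' b i) = 0"
    if k: "0 < k" and band: "\<And>a b. a \<le> b \<Longrightarrow> b < n \<Longrightarrow> k \<le> b - a \<Longrightarrow> (\<Sum>i\<in>V. w a i * w b i) = 0"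
      and ab: "a \<le> b" "b < n" "max (p - 1) k \<le> b - a" for k a b
  proof (cases "b < m")
    case True
    have "b - a \<le> js ! b - js ! a"
      using True ab(1) by (intro sorted_wrt_less_nth_diff) (simp_all add: js_def m_def)
    then have "k \<le> js ! b - js ! a" using ab by simp
    then have "(\<Sum>i\<in>V. w (js ! a) i * w (js ! b) i) = 0"
      using k js[OF True] by (intro band) auto
    then show ?thesis using True ab(1) by (simp add: w'_def)
  next
    case b: False
    show ?thesis
    proof (cases "a < m")
      case True
      then show ?thesis
        using orthogonal_lift[OF eig_js js(2), of a "N (b - m)"] b by (simp add: w'_def)
    next
      case False
      text \<open>Only the first and the last of the last \<open>p\<close> columns are this far apart.\<close>
      then have "a - m = 0" "\<not> b - m < p - 1" "0 < p - 1" using b ab k \<open>m + p = n\<close> by auto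
      then show ?thesis
        using sum_lift[of "M 0"] sum_M[of 0] False b
        by (simp add: w'_def N_def flip: sum_distrib_right)
    qed
  qed
  show thesis using 1 2 3 4 by (rule that)
qed

end

section \<open>Translation to matrices and graphs\<close>

lemma elements_mat_subset_iff:
  assumes "A \<in> carrier_mat nr nc"
  shows "elements_mat A \<subseteq> S \<longleftrightarrow> (\<forall>i<nr. \<forall>j<nc. A $$ (i, j) \<in> S)"
  using assms elements_matI[OF assms] by (fastforce dest!: elements_matD)

text \<open>With \<open>Q\<close> inverse to \<open>P\<close>, \<open>Q * L * P = D\<close> means
  \<open>L * P = P * D\<close>, which column by column is the eigenvector equation with the diagonal
  of \<open>D\<close> as eigenvalues.\<close>

lemma S_diagonalizes_iff_eigenbasis:
  assumes L: "L \<in> carrier_mat n n"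
  shows "S_diagonalizes S P L \<longleftrightarrow>
    P \<in> carrier_mat n n \<and> (\<forall>i<n. \<forall>j<n. P $$ (i, j) \<in> S) \<and>
    indep_family {..<n} {..<n} (\<lambda>j i. P $$ (i, j)) \<and>
    (\<exists>d. \<forall>i<n. \<forall>j<n. (\<Sum>k<n. L $$ (i, k) * P $$ (k, j)) = d j * P $$ (i, j))"
    (is "_ \<longleftrightarrow> ?carrier \<and> ?entries \<and> ?indep \<and> ?eigen")
proof -
  have prod: "(A * B) $$ (i, j) = (\<Sum>k<n. A $$ (i, k) * B $$ (k, j))"
    if "A \<in> carrier_mat n n" "B \<in> carrier_mat n n" "i < n" "j < n" for A B :: "complex mat" and i j
    using that by (auto simp: scalar_prod_def atLeast0LessThan)
  have entries: "elements_mat P \<subseteq> S \<longleftrightarrow> ?entries" if ?carrier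
    using that by (rule elements_mat_subset_iff)
  have "(\<exists>Q \<in> carrier_mat n n. inverts_mat P Q \<and> inverts_mat Q P \<and> diagonal_mat (Q * L * P))
      \<longleftrightarrow> ?indep \<and> ?eigen" if P: ?carrier
  proof
    assume "\<exists>Q \<in> carrier_mat n n. inverts_mat P Q \<and> inverts_mat Q P \<and> diagonal_mat (Q * L * P)"
    then obtain Q where Q: "Q \<in> carrier_mat n n" and inv: "P * Q = 1\<^sub>m n" "Q * P = 1\<^sub>m n"
      and diag: "diagonal_mat (Q * L * P)"
      using P by (auto simp: inverts_mat_def)
    have "det P * det Q = 1" using det_mult[OF P Q] inv by simp
    then have ?indep using indep_family_iff_det[OF P] by auto
    moreover have ?eigen
    proof (intro exI allI impI)
      fix i j assume ij: "i < n" "j < n"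
      define D where "D = Q * L * P"
      have D: "D \<in> carrier_mat n n" using Q L P by (simp add: D_def)
      have "P * D = P * (Q * (L * P))" using Q L P by (simp add: D_def assoc_mult_mat[of _ n n _ n _ n])
      also have "\<dots> = P * Q * (L * P)" using Q L P by (simp add: assoc_mult_mat[of _ n n _ n _ n])
      finally have "P * D = L * P" using inv L P by (simp add: left_mult_one_mat[of _ n n])
      then have "(\<Sum>k<n. L $$ (i, k) * P $$ (k, j)) = (\<Sum>k<n. P $$ (i, k) * D $$ (k, j))"
        using prod[OF L P ij] prod[OF P D ij] by simp
      also have "\<dots> = (\<Sum>k<n. if k = j then P $$ (i, j) * D $$ (j, j) else 0)"
        using diag D ij unfolding D_def[symmetric] diagonal_mat_def by (intro sum.cong) auto
      finally show "(\<Sum>k<n. L $$ (i, k) * P $$ (k, j)) = D $$ (j, j) * P $$ (i, j)"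
        using ij by simp
    qed
    ultimately show "?indep \<and> ?eigen" ..
  next
    assume "?indep \<and> ?eigen"
    then obtain d where det: "det P \<noteq> 0"
      and d: "\<forall>i<n. \<forall>j<n. (\<Sum>k<n. L $$ (i, k) * P $$ (k, j)) = d j * P $$ (i, j)"
      using indep_family_iff_det[OF P] by auto
    from det have "P \<in> Units (ring_mat TYPE(complex) n ())" by (rule det_non_zero_imp_unit[OF P])
    then obtain Q where Q: "Q \<in> carrier_mat n n" and inv: "P * Q = 1\<^sub>m n" "Q * P = 1\<^sub>m n"
      by (auto simp: Units_def ring_mat_def)
    define D where "D = mat n n (\<lambda>(i, j). if i = j then d j else 0)"
    have D: "D \<in> carrier_mat n n" by (simp add: D_def)
    have "L * P = P * D"
    proof (rule eq_matI)
      fix i j assume "i < dim_row (P * D)" "j < dim_col (P * D)"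
      then have ij: "i < n" "j < n" using P D by auto
      have "(P * D) $$ (i, j) = (\<Sum>k<n. if k = j then d j * P $$ (i, j) else 0)"
        unfolding prod[OF P D ij] using ij by (intro sum.cong) (auto simp: D_def)
      then show "(L * P) $$ (i, j) = (P * D) $$ (i, j)"
        using prod[OF L P ij] d ij by simp
    qed (use L P D in auto)
    then have "Q * L * P = Q * P * D"
      using Q L P D by (simp add: assoc_mult_mat[of _ n n _ n _ n])
    then have "Q * L * P = D" using inv D by simp
    then have "diagonal_mat (Q * L * P)" by (simp add: diagonal_mat_def D_def)
    then show "\<exists>Q \<in> carrier_mat n n. inverts_mat P Q \<and> inverts_mat Q P \<and> diagonal_mat (Q * L * P)"
      using P Q inv by (intro bexI[of _ Q]) (auto simp: inverts_mat_def)
  qed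
  then show ?thesis using entries L unfolding S_diagonalizes_def by auto
qed

section \<open>Bandwidth\<close>

lemma bandwidth_le_iff:
  assumes "0 < k"
  shows "bandwidth M \<le> k \<longleftrightarrow>
    (\<forall>i<dim_row M. \<forall>j<dim_col M. int k \<le> \<bar>int i - int j\<bar> \<longrightarrow> M $$ (i, j) = 0)"
    (is "_ \<longleftrightarrow> ?B k")
proof
  \<comment> \<open>No two indices are this far apart, so the minimum defining
    \<open>bandwidth\<close> is attained.\<close>
  have "0 < dim_row M + dim_col M + 1 \<and> ?B (dim_row M + dim_col M + 1)" by auto
  then have "0 < bandwidth M \<and> ?B (bandwidth M)" unfolding bandwidth_def by (rule LeastI)
  then show "?B k" if "bandwidth M \<le> k" using that by fastforce
  show "bandwidth M \<le> k" if "?B k"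
    unfolding bandwidth_def using assms that by (intro Least_le) simp
qed

lemma bandwidth_pos: "0 < bandwidth M"
proof -
  let ?B = "\<lambda>k. 0 < k \<and>
    (\<forall>i<dim_row M. \<forall>j<dim_col M. int k \<le> \<bar>int i - int j\<bar> \<longrightarrow> M $$ (i, j) = 0)"
  have "?B (dim_row M + dim_col M + 1)" by auto
  then have "?B (bandwidth M)" unfolding bandwidth_def by (rule LeastI)
  then show ?thesis by blast
qed

text \<open>The Gram matrix is symmetric, so the upper triangle suffices, and there the natural
  subtraction \<open>b - a\<close> is the index distance.\<close>

lemma bandwidth_gram_le_iff:
  assumes P: "P \<in> carrier_mat n n" and k: "0 < k"
  shows "bandwidth (P\<^sup>T * P) \<le> k \<longleftrightarrow>
    (\<forall>a b. a \<le> b \<longrightarrow> b < n \<longrightarrow> k \<le> b - a \<longrightarrow> (\<Sum>i<n. P $$ (i, a) * P $$ (i, b)) = 0)"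
proof -
  have entry: "(P\<^sup>T * P) $$ (a, b) = (\<Sum>i<n. P $$ (i, a) * P $$ (i, b))" if "a < n" "b < n" for a b
    using P that by (auto simp: scalar_prod_def atLeast0LessThan)
  have sym: "(P\<^sup>T * P) $$ (a, b) = (P\<^sup>T * P) $$ (b, a)" if "a < n" "b < n" for a b
    using that by (simp add: entry mult.commute)
  have "bandwidth (P\<^sup>T * P) \<le> k \<longleftrightarrow>
      (\<forall>a<n. \<forall>b<n. int k \<le> \<bar>int a - int b\<bar> \<longrightarrow> (P\<^sup>T * P) $$ (a, b) = 0)"
    using P by (subst bandwidth_le_iff[OF k]) simp
  also have "\<dots> \<longleftrightarrow> (\<forall>a b. a \<le> b \<longrightarrow> b < n \<longrightarrow> k \<le> b - a \<longrightarrow> (P\<^sup>T * P) $$ (a, b) = 0)"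
  proof (intro iffI allI impI)
    fix a b
    assume *: "\<forall>a b. a \<le> b \<longrightarrow> b < n \<longrightarrow> k \<le> b - a \<longrightarrow> (P\<^sup>T * P) $$ (a, b) = 0"
      and ab: "a < n" "b < n" "int k \<le> \<bar>int a - int b\<bar>"
    show "(P\<^sup>T * P) $$ (a, b) = 0"
    proof (cases "a \<le> b")
      case True
      then show ?thesis using *[rule_format, of a b] ab by simp
    next
      case False
      then show ?thesis using *[rule_format, of b a] sym[of a b] ab by simp
    qed
  next
    fix a b
    assume "\<forall>a<n. \<forall>b<n. int k \<le> \<bar>int a - int b\<bar> \<longrightarrow> (P\<^sup>T * P) $$ (a, b) = 0"
      and "a \<le> b" "b < n" "k \<le> b - a"
    then show "(P\<^sup>T * P) $$ (a, b) = 0" by auto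
  qed
  finally show ?thesis using entry by auto
qed

text \<open>Every diagonalizing \<open>P\<close> competes in the minimum because bandwidths are
  positive; if there is none, the value is infinite and neither side holds.\<close>

lemma S_bandwidth_le_iff:
  "S_bandwidth S vs G \<le> enat k \<longleftrightarrow>
    (\<exists>P. S_diagonalizes S P (laplacian vs G) \<and> bandwidth (P\<^sup>T * P) \<le> k)"
proof (cases "S_diagonalizable S vs G")
  case True
  let ?Q = "\<lambda>k. 0 < k \<and> (\<exists>P. S_diagonalizes S P (laplacian vs G) \<and> bandwidth (P\<^sup>T * P) = k)"
  have Q: "?Q (bandwidth (P\<^sup>T * P))" if "S_diagonalizes S P (laplacian vs G)" for P
    using that bandwidth_pos by blast
  then have "?Q (LEAST k. ?Q k)" using True LeastI[of ?Q] unfolding S_diagonalizable_def by blast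
  moreover have "(LEAST k. ?Q k) \<le> bandwidth (P\<^sup>T * P)" if "S_diagonalizes S P (laplacian vs G)" for P
    using Q[OF that] by (rule Least_le)
  ultimately show ?thesis using True unfolding S_bandwidth_def by (auto intro: le_trans)
next
  case False
  then show ?thesis by (auto simp: S_bandwidth_def S_diagonalizable_def)
qed

section \<open>Balanced vectors\<close>

lemma span_singleton_vec:
  fixes u :: "'f::field vec"
  assumes "u \<in> carrier_vec p"
  shows "module.span class_ring (module_vec TYPE('f) p) {u} = {t \<cdot>\<^sub>v u | t. True}"
proof -
  interpret vec_space "TYPE('f)" p .
  have single: "lincomb a {u} = a u \<cdot>\<^sub>v u" for a
    using assms by (simp add: lincomb_def)
  \<comment> \<open>The span also admits combinations over the empty set, which give the zero
    multiple of \<open>u\<close>.\<close>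
  have empty: "lincomb a {} = 0 \<cdot>\<^sub>v u" for a
    using assms by (auto simp: lincomb_def)
  show ?thesis
  proof (intro equalityI subsetI)
    fix x assume "x \<in> span {u}"
    then obtain a A where x: "x = lincomb a A" and "A \<subseteq> {u}" unfolding span_def by blast
    then have "A = {} \<or> A = {u}" by blast
    then show "x \<in> {t \<cdot>\<^sub>v u | t. True}" using x single empty by auto
  next
    fix x assume "x \<in> {t \<cdot>\<^sub>v u | t. True}"
    then obtain t where "x = lincomb (\<lambda>_. t) {u}" using single by auto
    then show "x \<in> span {u}" unfolding span_def by blast
  qed
qed

lemma S_balanced_vec_iff:
  assumes "c0 < p" "u c0 \<noteq> 0"
  shows "S_balanced S (vec p u) \<longleftrightarrow>
    (\<exists>M. (\<forall>r<p - 1. \<forall>c<p. M r c \<in> S) \<and>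
      (\<forall>z. (\<forall>r<p - 1. (\<Sum>c<p. M r c * z c) = 0) \<longleftrightarrow> (\<exists>t. \<forall>c<p. z c = t * u c)))"
proof (cases "p = 1")
  case True
  then have "vec p u \<noteq> 0\<^sub>v p" using assms by (auto simp: vec_eq_iff)
  \<comment> \<open>Without rows every \<open>z\<close> is a null vector, and it is a multiple of
    \<open>u\<close> because \<open>u 0\<close> is nonzero.\<close>
  moreover have "\<exists>t. z 0 = t * u 0" for z :: "nat \<Rightarrow> complex"
    using assms True by (intro exI[of _ "z 0 / u 0"]) simp
  ultimately show ?thesis using True by (simp add: S_balanced_def)
next
  case False
  then have p: "p \<ge> 2" using assms(1) by simp
  have entries: "elements_mat M \<subseteq> S \<longleftrightarrow> (\<forall>r<p - 1. \<forall>c<p. M $$ (r, c) \<in> S)"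
    if "M \<in> carrier_mat (p - 1) p" for M
    using that by (rule elements_mat_subset_iff)
  have kernel: "mat_kernel M = module.span class_ring (module_vec TYPE(complex) p) {vec p u} \<longleftrightarrow>
    (\<forall>z. (\<forall>r<p - 1. (\<Sum>c<p. M $$ (r, c) * z c) = 0) \<longleftrightarrow> (\<exists>t. \<forall>c<p. z c = t * u c))"
    if M: "M \<in> carrier_mat (p - 1) p" for M
  proof -
    have 1: "x \<in> mat_kernel M \<longleftrightarrow> (\<forall>r<p - 1. (\<Sum>c<p. M $$ (r, c) * x $ c) = 0)"
      if "x \<in> carrier_vec p" for x
      using M that by (auto simp: mat_kernel_def vec_eq_iff scalar_prod_def atLeast0LessThan)
    have 2: "x \<in> {t \<cdot>\<^sub>v vec p u | t. True} \<longleftrightarrow> (\<exists>t. \<forall>c<p. x $ c = t * u c)"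
      if "x \<in> carrier_vec p" for x
      using that by (auto simp: vec_eq_iff)
    have "mat_kernel M \<subseteq> carrier_vec p" using M by (auto simp: mat_kernel_def)
    moreover have "{t \<cdot>\<^sub>v vec p u | t. True} \<subseteq> carrier_vec p" by auto
    ultimately have "mat_kernel M = {t \<cdot>\<^sub>v vec p u | t. True} \<longleftrightarrow>
        (\<forall>x\<in>carrier_vec p. x \<in> mat_kernel M \<longleftrightarrow> x \<in> {t \<cdot>\<^sub>v vec p u | t. True})"
      by blast
    also have "\<dots> \<longleftrightarrow> (\<forall>x\<in>carrier_vec p. (\<forall>r<p - 1. (\<Sum>c<p. M $$ (r, c) * x $ c) = 0) \<longleftrightarrow>
        (\<exists>t. \<forall>c<p. x $ c = t * u c))"
      using 1 2 by (intro ball_cong) auto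
    also have "\<dots> \<longleftrightarrow> (\<forall>z. (\<forall>r<p - 1. (\<Sum>c<p. M $$ (r, c) * z c) = 0) \<longleftrightarrow>
        (\<exists>t. \<forall>c<p. z c = t * u c))" (is "?l \<longleftrightarrow> ?r")
    proof
      assume ?l
      \<comment> \<open>A function \<open>z\<close> enters as \<open>vec p z\<close>, since only its
        values below \<open>p\<close> matter.\<close>
      then show ?r
        by (intro allI) (drule bspec[of _ _ "vec p _"], auto)
    qed blast
    finally show ?thesis by (simp add: span_singleton_vec)
  qed
  show ?thesis
  proof
    assume "S_balanced S (vec p u)"
    then obtain M where M: "M \<in> carrier_mat (p - 1) p" "elements_mat M \<subseteq> S"
      "mat_kernel M = module.span class_ring (module_vec TYPE(complex) p) {vec p u}"
      using p False by (auto simp: S_balanced_def Let_def)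
    then show "\<exists>M. (\<forall>r<p - 1. \<forall>c<p. M r c \<in> S) \<and>
      (\<forall>z. (\<forall>r<p - 1. (\<Sum>c<p. M r c * z c) = 0) \<longleftrightarrow> (\<exists>t. \<forall>c<p. z c = t * u c))"
      using entries[OF M(1)] kernel[OF M(1)] by (intro exI[of _ "\<lambda>r c. M $$ (r, c)"]) simp
  next
    assume "\<exists>M. (\<forall>r<p - 1. \<forall>c<p. M r c \<in> S) \<and>
      (\<forall>z. (\<forall>r<p - 1. (\<Sum>c<p. M r c * z c) = 0) \<longleftrightarrow> (\<exists>t. \<forall>c<p. z c = t * u c))"
    then obtain M where M: "\<forall>r<p - 1. \<forall>c<p. M r c \<in> S"
      "\<forall>z. (\<forall>r<p - 1. (\<Sum>c<p. M r c * z c) = 0) \<longleftrightarrow> (\<exists>t. \<forall>c<p. z c = t * u c)" by blast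
    let ?M = "mat (p - 1) p (\<lambda>(r, c). M r c)"
    have "elements_mat ?M \<subseteq> S"
      using M(1) by (subst entries) auto
    moreover have "mat_kernel ?M = module.span class_ring (module_vec TYPE(complex) p) {vec p u}"
      using M(2) by (subst kernel) simp_all
    ultimately show "S_balanced S (vec p u)"
      unfolding S_balanced_def Let_def dim_vec using p by (intro disjI2 conjI bexI[of _ ?M]) auto
  qed
qed

section \<open>The graph on list positions\<close>

definition index_arcs :: "'a list \<Rightarrow> 'a rel \<Rightarrow> nat rel" where
  "index_arcs vs R = {(i, j). i < length vs \<and> j < length vs \<and> (vs ! i, vs ! j) \<in> R}"

text \<open>Out-arcs of a vertex correspond to positions in \<open>vs\<close>, so the degree is a
  sum of indicators along the row and merges with the adjacency entries into differences.\<close>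

lemma laplacian_row_sum:
  assumes vs: "distinct vs" "set vs = pverts G" and wf: "pair_wf_digraph G" and i: "i < length vs"
  shows "(\<Sum>k<length vs. laplacian vs G $$ (i, k) * x k)
    = laplace_op {..<length vs} (index_arcs vs (parcs G)) x i"
proof -
  interpret pair_wf_digraph G by (rule wf)
  let ?n = "length vs" and ?E = "index_arcs vs (parcs G)"
  let ?e = "\<lambda>k. of_bool ((i, k) \<in> ?E) :: complex"
  have "out_arcs (with_proj G) (vs ! i) = (\<lambda>k. (vs ! i, vs ! k)) ` {k. k < ?n \<and> (i, k) \<in> ?E}"
  proof (intro equalityI subsetI)
    fix a assume "a \<in> out_arcs (with_proj G) (vs ! i)"
    then obtain b where b: "a = (vs ! i, b)" "(vs ! i, b) \<in> parcs G" by (cases a) auto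
    then obtain k where "k < ?n" "vs ! k = b" using in_arcsD2 vs(2) by (metis in_set_conv_nth)
    then show "a \<in> (\<lambda>k. (vs ! i, vs ! k)) ` {k. k < ?n \<and> (i, k) \<in> ?E}"
      using b i by (auto simp: index_arcs_def)
  qed (auto simp: index_arcs_def)
  moreover have "inj_on (\<lambda>k. (vs ! i, vs ! k)) {k. k < ?n \<and> (i, k) \<in> ?E}"
    using vs(1) by (auto simp: inj_on_def nth_eq_iff_index_eq)
  ultimately have "out_degree (with_proj G) (vs ! i) = card {k. k < ?n \<and> (i, k) \<in> ?E}"
    by (simp add: out_degree_def card_image)
  also have "of_nat \<dots> = (\<Sum>k<?n. ?e k)"
    by (simp add: of_bool_def sum.If_cases Int_def)
  finally have deg: "of_nat (out_degree (with_proj G) (vs ! i)) = (\<Sum>k<?n. ?e k)" .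
  have "(\<Sum>k<?n. laplacian vs G $$ (i, k) * x k)
      = (\<Sum>k<?n. (if k = i then of_nat (out_degree (with_proj G) (vs ! i)) * x i else 0) - ?e k * x k)"
    using i by (intro sum.cong)
      (auto simp: laplacian_def degree_mat_def adjacency_mat_def index_arcs_def left_diff_distrib)
  also have "\<dots> = (\<Sum>k<?n. ?e k * (x i - x k))"
    using i by (simp add: sum_subtractf deg sum_distrib_right right_diff_distrib)
  also have "\<dots> = laplace_op {..<?n} ?E x i"
    unfolding laplace_op_def by (intro sum.cong) auto
  finally show ?thesis .
qed

lemma S_diagonalizes_laplacian_iff:
  assumes "distinct vs" "set vs = pverts G" "pair_wf_digraph G" and n: "n = length vs"
  shows "S_diagonalizes S P (laplacian vs G) \<longleftrightarrow>
    P \<in> carrier_mat n n \<and> (\<forall>i<n. \<forall>j<n. P $$ (i, j) \<in> S) \<and>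
    indep_family {..<n} {..<n} (\<lambda>j i. P $$ (i, j)) \<and>
    (\<exists>d. \<forall>i<n. \<forall>j<n. laplace_op {..<n} (index_arcs vs (parcs G)) (\<lambda>i. P $$ (i, j)) i
      = d j * P $$ (i, j))"
proof -
  have "laplacian vs G \<in> carrier_mat n n"
    by (simp add: n laplacian_def degree_mat_def adjacency_mat_def carrier_matI)
  moreover have "(\<Sum>k<n. laplacian vs G $$ (i, k) * P $$ (k, j))
      = laplace_op {..<n} (index_arcs vs (parcs G)) (\<lambda>i. P $$ (i, j)) i" if "i < n" for i j
    using laplacian_row_sum[OF assms(1-3), of i "\<lambda>k. P $$ (k, j)"] that n by simp
  ultimately show ?thesis
    by (simp add: S_diagonalizes_iff_eigenbasis)
qed

lemma pair_wf_digraph_complement_graph: "pair_wf_digraph (complement_graph G)"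
  by unfold_locales (auto simp: complement_graph_def)

text \<open>In a symmetric digraph the strongly connected components are the connected components:
  arcs stay inside them, and a kernel function keeps its value along every path.\<close>

lemma laplace_kernel_index_arcs:
  assumes G: "pair_graph G" and "pverts G \<noteq> {}"
    and vs: "distinct vs" "set vs = pverts G"
    and cs: "set cs = pre_digraph.sccs_verts (with_proj G)" "length cs = p"
    and \<kappa>: "\<And>i c. i < length vs \<Longrightarrow> c < p \<Longrightarrow> \<kappa> i = c \<longleftrightarrow> vs ! i \<in> cs ! c"
    and \<kappa>_less: "\<And>i. i < length vs \<Longrightarrow> \<kappa> i < p"
  shows "laplace_kernel {..<length vs} (index_arcs vs (parcs G)) \<kappa> p"
proof
  interpret pair_graph G by (rule G)
  let ?n = "length vs" and ?E = "index_arcs vs (parcs G)"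
  have scc: "cs ! c \<in> sccs_verts" if "c < p" for c
    using that cs by (metis nth_mem)
  have reach: "vs ! i \<rightarrow>\<^sup>*\<^bsub>with_proj G\<^esub> vs ! k"
    if "i < ?n" "k < ?n" "\<kappa> i = \<kappa> k" for i k
    using scc[of "\<kappa> i"] \<kappa>[of i "\<kappa> i"] \<kappa>[of k "\<kappa> i"] \<kappa>_less that
    by (auto simp: in_sccs_verts_conv_reachable)
  show "finite {..<?n}" by simp
  show symE: "sym ?E"
    using arcs_symmetric by (auto simp: index_arcs_def intro!: symI)
  show "irrefl ?E"
    using no_loops' by (auto simp: index_arcs_def irrefl_def)
  show "\<kappa> ` {..<?n} = {..<p}"
  proof (intro equalityI subsetI)
    fix c assume "c \<in> {..<p}"
    then have c: "c < p" by simp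
    then obtain u where u: "u \<in> cs ! c" using scc[OF c] by (auto simp: in_sccs_verts_conv_reachable)
    then have "u \<rightarrow>\<^sup>*\<^bsub>with_proj G\<^esub> u" using scc[OF c] by (auto simp: in_sccs_verts_conv_reachable)
    then have "u \<in> set vs" using vs(2) reachable_in_verts(1) by simp
    then obtain i where "i < ?n" "vs ! i = u" by (auto simp: in_set_conv_nth)
    then show "c \<in> \<kappa> ` {..<?n}" using \<kappa> c u by blast
  qed (use \<kappa>_less in auto)
  show "{..<?n} \<noteq> {}" using vs(2) \<open>pverts G \<noteq> {}\<close> by (cases vs) auto
  show "\<kappa> i = \<kappa> k" if "i \<in> {..<?n}" "k \<in> {..<?n}" "(i, k) \<in> ?E" for i k
  proof -
    have "vs ! i \<rightarrow>\<^sup>*\<^bsub>with_proj G\<^esub> vs ! k" "vs ! k \<rightarrow>\<^sup>*\<^bsub>with_proj G\<^esub> vs ! i"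
      using that(3) symD[OF symE that(3)] by (auto simp: index_arcs_def)
    moreover have "vs ! i \<in> cs ! \<kappa> i" using \<kappa> \<kappa>_less that by auto
    ultimately have "vs ! k \<in> cs ! \<kappa> i"
      using scc[OF \<kappa>_less] that unfolding in_sccs_verts_conv_reachable by blast
    then show ?thesis using \<kappa>[of k "\<kappa> i"] \<kappa>_less that by auto
  qed
  show "x i = x k" if ker: "\<And>i. i \<in> {..<?n} \<Longrightarrow> laplace_op {..<?n} ?E x i = 0"
    and ik: "i \<in> {..<?n}" "k \<in> {..<?n}" "\<kappa> i = \<kappa> k" for x :: "nat \<Rightarrow> complex" and i k
  proof -
    \<comment> \<open>Induction along the path; the claim ranges over positions \<open>l\<close>
      because \<open>x\<close> lives on positions while reachability lives on vertices.\<close>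
    have "\<forall>l<?n. vs ! l = u \<longrightarrow> x i = x l" if "vs ! i \<rightarrow>\<^sup>*\<^bsub>with_proj G\<^esub> u" for u
      using that
    proof (induction rule: reachable_induct)
      case base
      then show ?case using vs(1) ik(1) by (auto simp: nth_eq_iff_index_eq)
    next
      case (step a b)
      show ?case
      proof (intro allI impI)
        fix l assume l: "l < ?n" "vs ! l = b"
        have ab: "(a, b) \<in> parcs G" using step.hyps by simp
        then obtain m where m: "m < ?n" "vs ! m = a"
          using in_arcsD1 vs(2) by (metis in_set_conv_nth)
        have "x m = x l"
          using m l ab by (intro laplace_op_kernel_adjacent[OF symE _ ker]) (auto simp: index_arcs_def)
        then show "x i = x l" using step.IH m by simp
      qed
    qed
    from this[OF reach[of i k]] show ?thesis using ik by simp
  qed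
qed

section \<open>Numbering the components and combining both directions\<close>

theorem theorem5p5:
  fixes S :: "complex set"
    and G :: "'a pair_pre_digraph"
    and vs :: "'a list"
    and cs :: "'a set list"
    and p :: nat
    and v :: "nat \<Rightarrow> nat"
  assumes "pair_graph G"
    and "pverts G \<noteq> {}"
    and "distinct vs" and "set vs = pverts G"
    and "distinct cs" and "set cs = pre_digraph.sccs_verts (with_proj G)" and "length cs = p"
    and "\<And>i. i < p \<Longrightarrow> v i = card (cs ! i)"
    and "S_diagonalizable S vs G"
  shows "(S_diagonalizable S vs (complement_graph G) \<longleftrightarrow>
            S_balanced S (vec p (\<lambda>i. of_nat (v i)))) \<and>
         (S_diagonalizable S vs (complement_graph G) \<longrightarrow>
            (\<forall>k. S_bandwidth S vs G = enat k \<longrightarrow>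
               S_bandwidth S vs (complement_graph G) \<le> enat (max (p - 1) k)))"
proof -
  interpret pair_graph G by fact
  note vs = \<open>distinct vs\<close> \<open>set vs = pverts G\<close>
  define n where "n = length vs"
  let ?V = "{..<n}" and ?E = "index_arcs vs (parcs G)" and ?Gc = "complement_graph G"
  have scc: "cs ! c \<in> sccs_verts" if "c < p" for c
    using that assms(6,7) by (metis nth_mem)
  \<comment> \<open>The components partition the vertices, so the numbering \<open>\<kappa>\<close>
    is well defined.\<close>
  have ex1: "\<exists>!c. c < p \<and> vs ! i \<in> cs ! c" if "i < n" for i
  proof -
    have "vs ! i \<in> pverts G" using that nth_mem[of i vs] vs(2) by (simp add: n_def)
    then have "vs ! i \<in> scc_of (vs ! i)" "scc_of (vs ! i) \<in> set cs"
      using in_scc_of_self scc_of_in_sccs_verts assms(6) by simp_all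
    then obtain c where c: "c < p" "vs ! i \<in> cs ! c"
      using assms(7) by (metis in_set_conv_nth)
    moreover have "c' = c" if "c' < p" "vs ! i \<in> cs ! c'" for c'
    proof -
      have "cs ! c' = cs ! c"
        using sccs_verts_disjoint[OF scc scc, of c' c] c that by blast
      then show ?thesis using \<open>distinct cs\<close> c that assms(7) by (simp add: nth_eq_iff_index_eq)
    qed
    ultimately show ?thesis by blast
  qed
  define \<kappa> where "\<kappa> i = (THE c. c < p \<and> vs ! i \<in> cs ! c)" for i
  have \<kappa>: "\<kappa> i < p" "vs ! i \<in> cs ! \<kappa> i" if "i < n" for i
    using theI'[OF ex1[OF that]] by (simp_all add: \<kappa>_def)
  have \<kappa>_iff: "\<kappa> i = c \<longleftrightarrow> vs ! i \<in> cs ! c" if "i < n" "c < p" for i c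
    using \<kappa>[OF that(1)] ex1[OF that(1)] that(2) by blast
  interpret laplace_kernel ?V ?E \<kappa> p
    using laplace_kernel_index_arcs[of G vs cs p \<kappa>] assms \<kappa>_iff \<kappa> by (simp add: n_def)
  have \<nu>: "\<nu> c = of_nat (v c)" if "c < p" for c
  proof -
    have "(!) vs ` {i \<in> ?V. \<kappa> i = c} = cs ! c"
    proof (intro equalityI subsetI)
      fix u assume u: "u \<in> cs ! c"
      then have "u \<rightarrow>\<^sup>*\<^bsub>with_proj G\<^esub> u" using scc[OF that] by (auto simp: in_sccs_verts_conv_reachable)
      then have "u \<in> set vs" using vs(2) reachable_in_verts(1) by simp
      then obtain i where "i < n" "vs ! i = u" by (auto simp: in_set_conv_nth n_def)
      then show "u \<in> (!) vs ` {i \<in> ?V. \<kappa> i = c}" using \<kappa>_iff that u by auto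
    qed (use \<kappa>_iff that in auto)
    moreover have "inj_on ((!) vs) {i \<in> ?V. \<kappa> i = c}"
      using vs(1) by (auto simp: inj_on_def nth_eq_iff_index_eq n_def)
    ultimately show ?thesis
      using assms(8)[OF that] by (simp add: \<nu>_def flip: card_image)
  qed
  \<comment> \<open>Complementing commutes with passing to positions, as distinct positions carry
    distinct vertices.\<close>
  have complement_arcs: "index_arcs vs (parcs ?Gc) = complement_arcs"
    unfolding complement_arcs_def using nth_mem[of _ vs] vs
    by (auto simp: index_arcs_def complement_graph_def n_def nth_eq_iff_index_eq)
  note diag_G = S_diagonalizes_laplacian_iff[OF vs pair_wf_digraph_axioms n_def]
  have vs': "set vs = pverts ?Gc" using vs(2) by (simp add: complement_graph_def)
  note diag_Gc = S_diagonalizes_laplacian_iff[OF vs(1) vs' pair_wf_digraph_complement_graph n_def, unfolded complement_arcs]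
  have "vec p (\<lambda>c. of_nat (v c)) = vec p \<nu>" using \<nu> by auto
  then have balanced: "S_balanced S (vec p (\<lambda>i. of_nat (v i))) \<longleftrightarrow>
      (\<exists>M. (\<forall>r<p - 1. \<forall>c<p. M r c \<in> S) \<and> balanced_rows M)"
    using S_balanced_vec_iff[of 0 p \<nu> S] p_pos \<nu>_nonzero[OF p_pos] by (simp add: balanced_rows_def)
  have only_if: "S_balanced S (vec p (\<lambda>i. of_nat (v i)))" if co: "S_diagonalizable S vs ?Gc"
  proof -
    obtain P e where P: "\<forall>i<n. \<forall>j<n. P $$ (i, j) \<in> S"
      and ind: "indep_family ?V ?V (\<lambda>j i. P $$ (i, j))"
      and e: "\<forall>i<n. \<forall>j<n. laplace_op ?V complement_arcs (\<lambda>i. P $$ (i, j)) i = e j * P $$ (i, j)"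
      using co unfolding S_diagonalizable_def diag_Gc by blast
    show ?thesis
      unfolding balanced using P e by (intro balanced_rows_if_complement_arcs_eigenbasis[OF _ _ ind]) auto
  qed
  \<comment> \<open>One matrix \<open>P'\<close>, chosen before \<open>k\<close>, yields both
    diagonalizability of the complement and the bandwidth bound.\<close>
  have construct: "\<exists>P'. S_diagonalizes S P' (laplacian vs ?Gc) \<and>
      (\<forall>k>0. bandwidth (P\<^sup>T * P) \<le> k \<longrightarrow> bandwidth (P'\<^sup>T * P') \<le> max (p - 1) k)"
    if P: "S_diagonalizes S P (laplacian vs G)" and bal: "S_balanced S (vec p (\<lambda>i. of_nat (v i)))" for P
  proof -
    obtain d where PC: "P \<in> carrier_mat n n" and PS: "\<forall>i<n. \<forall>j<n. P $$ (i, j) \<in> S"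
      and ind: "indep_family ?V ?V (\<lambda>j i. P $$ (i, j))"
      and d: "\<forall>i<n. \<forall>j<n. laplace_op ?V ?E (\<lambda>i. P $$ (i, j)) i = d j * P $$ (i, j)"
      using P unfolding diag_G by blast
    obtain M where M: "\<forall>r<p - 1. \<forall>c<p. M r c \<in> S" "balanced_rows M"
      using bal unfolding balanced by blast
    obtain w e where w_ind: "indep_family ?V ?V w"
      and w_eig: "\<And>i j. i \<in> ?V \<Longrightarrow> j < n \<Longrightarrow> laplace_op ?V complement_arcs (w j) i = e j * w j i"
      and w_S: "\<And>i j. i \<in> ?V \<Longrightarrow> j < n \<Longrightarrow> w j i \<in> S"
      and w_band: "\<And>k a b. \<lbrakk>0 < k;
           \<And>a b. a \<le> b \<Longrightarrow> b < n \<Longrightarrow> k \<le> b - a \<Longrightarrow> (\<Sum>i<n. P $$ (i, a) * P $$ (i, b)) = 0;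
           a \<le> b; b < n; max (p - 1) k \<le> b - a\<rbrakk> \<Longrightarrow> (\<Sum>i<n. w a i * w b i) = 0"
      using complement_arcs_eigenbasis_if_balanced_rows[of n "\<lambda>j i. P $$ (i, j)" d S M] ind d PS M by auto
    define P' where "P' = mat n n (\<lambda>(i, j). w j i)"
    have P'C: "P' \<in> carrier_mat n n" by (simp add: P'_def)
    have P'w: "P' $$ (i, j) = w j i" if "i < n" "j < n" for i j using that by (simp add: P'_def)
    have "indep_family ?V ?V (\<lambda>j i. P' $$ (i, j))"
      using w_ind by (simp add: indep_family_def P'w)
    moreover have "laplace_op ?V complement_arcs (\<lambda>i. P' $$ (i, j)) i = e j * P' $$ (i, j)" if "i < n" "j < n" for i j
    proof -
      have "laplace_op ?V complement_arcs (\<lambda>i. P' $$ (i, j)) i = laplace_op ?V complement_arcs (w j) i"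
        unfolding laplace_op_def using that P'w by (intro sum.cong) auto
      then show ?thesis using w_eig that P'w by simp
    qed
    ultimately have "S_diagonalizes S P' (laplacian vs ?Gc)"
      unfolding diag_Gc using w_S P'w P'C by auto
    moreover have "bandwidth (P'\<^sup>T * P') \<le> max (p - 1) k"
      if k: "0 < k" "bandwidth (P\<^sup>T * P) \<le> k" for k
    proof -
      have k': "0 < max (p - 1) k" using k(1) by simp
      have "(\<Sum>i<n. P' $$ (i, a) * P' $$ (i, b)) = 0"
        if "a \<le> b" "b < n" "max (p - 1) k \<le> b - a" for a b
      proof -
        have "(\<Sum>i<n. P' $$ (i, a) * P' $$ (i, b)) = (\<Sum>i<n. w a i * w b i)"
          using that by (intro sum.cong) (auto simp: P'w)
        also have "\<dots> = 0"
          using k that unfolding bandwidth_gram_le_iff[OF PC k(1)] by (intro w_band) blast+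
        finally show ?thesis .
      qed
      then show ?thesis unfolding bandwidth_gram_le_iff[OF P'C k'] by blast
    qed
    ultimately show ?thesis by blast
  qed
  show ?thesis
  proof (intro conjI iffI impI allI)
    assume "S_diagonalizable S vs ?Gc"
    then show "S_balanced S (vec p (\<lambda>i. of_nat (v i)))" by (rule only_if)
  next
    assume "S_balanced S (vec p (\<lambda>i. of_nat (v i)))"
    then show "S_diagonalizable S vs ?Gc"
      using construct \<open>S_diagonalizable S vs G\<close> unfolding S_diagonalizable_def by blast
  next
    fix k assume co: "S_diagonalizable S vs ?Gc" and k: "S_bandwidth S vs G = enat k"
    then obtain P where P: "S_diagonalizes S P (laplacian vs G)" "bandwidth (P\<^sup>T * P) \<le> k"
      using S_bandwidth_le_iff[of S vs G k] by auto
    \<comment> \<open>The bound in \<open>construct\<close> requires a positive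
      \<open>k\<close>.\<close>
    moreover have "0 < k" using P(2) bandwidth_pos[of "P\<^sup>T * P"] by linarith
    ultimately show "S_bandwidth S vs ?Gc \<le> enat (max (p - 1) k)"
      using construct[OF P(1) only_if[OF co]] unfolding S_bandwidth_le_iff by blast
  qed
qed

end
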